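(* Let $t\not\equiv 0\pmod 4$ be a fixed positive integer and let $n$ and $k<n$ be positive integers such that $t\mid 2nk$ and such that one of the following holds: (1) $nk$ is odd, $n\geq k\geq 3$, and $\gcd(n,k-1)=1$; (2) $nk$ is odd, $n\geq k$, and $3<k<200$; (3) $nk$ is odd, $n\geq k\geq 3$, and $n\geq (k-2)(k-1)$. Then the number of distinct biembeddings $\Pi$ of $K_{\frac{2nk+t}{t}\times t}$ such that (a) $\mathrm{Aut}(\Pi)=\mathbb{Z}_{2nk+t}$, (b) the faces determined by $\Pi$ have lengths multiples of $k$, is at least $$\left(1-O\left(\tfrac{1}{nk}\right)\right)(nk)!.$$
   Context: Asymptotic convention: $t$ is fixed and the constant implied in $O(\cdot)$ depends only on $t$. Let $v=2nk+t$. $K_{\frac{v}{t}\times t}$ is the complete multipartite graph with $v/t$ parts of size $t$; its vertex set is identified with $\mathbb{Z}_v$, two vertices being adjacent iff their difference is not in the subgroup $J=\frac{v}{t}\mathbb{Z}_v$ of order $t$. A (combinatorial, orientable) embedding of a connected graph $\Gamma$ is a pair $\Pi=(\Gamma,\rho)$ where $\rho$ is a permutation of the oriented edges with $\rho(x,y)=(x,\rho_x(y))$, each $\rho_x$ being a cyclic permutation of all neighbours of $x$; this is equivalent to a cellular embedding into an orientable surface. Two embeddings of the same (labelled) graph are distinct if their rotations $\rho$ are different. Face boundaries are traced by the orbits of $(x,y)\mapsto\rho(y,x)$; the length of a face is the length of the orbit. A biembedding is an embedding whose faces can be coloured with two colours so that each edge lies on one face of each colour. $\mathrm{Aut}(\Pi)$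 is the group of graph automorphisms $\sigma$ (acting on oriented edges by $\sigma(x,y)=(\sigma(x),\sigma(y))$) such that either $\sigma\circ\rho=\rho\circ\sigma$ or $\sigma\circ\rho=\rho^{-1}\circ\sigma$; $\mathrm{Aut}(\Pi)=\mathbb{Z}_v$ means that it consists exactly of the translations $\tau_g(x)=x+g$, $g\in\mathbb{Z}_v$. *)

theory Defs
  imports Complex_Main "HOL-Combinatorics.Orbits" "HOL-Number_Theory.Cong" "Graph_Theory.Graph_Theory"
begin

text \<open>
  A finite simple graph is a \<^locale>\<open>pair_graph\<close> (finite, symmetric, loop-free digraph without
  parallel arcs), so that \<^term>\<open>parcs G\<close> is its set of oriented edges.
\<close>

definition neighbours :: "'a pair_pre_digraph \<Rightarrow> 'a \<Rightarrow> 'a set" where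
  "neighbours G x = {y. (x, y) \<in> parcs G}"

text \<open>
  The pair of \<open>G\<close> and \<open>\<rho>\<close> is a combinatorial embedding. Since \<open>permutes\<close> forces \<open>\<rho>\<close> to be the
  identity off the oriented edges, two embeddings of \<open>G\<close> are distinct iff the functions \<open>\<rho>\<close> are
  different, and there are only finitely many of them.
\<close>

definition embedding :: "'a pair_pre_digraph \<Rightarrow> ('a \<times> 'a \<Rightarrow> 'a \<times> 'a) \<Rightarrow> bool" where
  "embedding G \<rho> \<longleftrightarrow>
     pair_graph G \<and> Digraph_Component.connected (with_proj G) \<and> \<rho> permutes parcs G \<and>
     (\<exists>r. \<forall>x\<in>pverts G.
        r x permutes neighbours G x \<and> cyclic_on (r x) (neighbours G x) \<and>
        (\<forall>y\<in>neighbours G x. \<rho> (x, y) = (x, r x y)))"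

definition face_step :: "('a \<times> 'a \<Rightarrow> 'a \<times> 'a) \<Rightarrow> 'a \<times> 'a \<Rightarrow> 'a \<times> 'a" where
  "face_step \<rho> = (\<lambda>(x, y). \<rho> (y, x))"

text \<open>A face is given by its boundary, a set of oriented edges; its length is its cardinality.\<close>

definition faces :: "'a pair_pre_digraph \<Rightarrow> ('a \<times> 'a \<Rightarrow> 'a \<times> 'a) \<Rightarrow> ('a \<times> 'a) set set" where
  "faces G \<rho> = orbit (face_step \<rho>) ` parcs G"

definition biembedding :: "'a pair_pre_digraph \<Rightarrow> ('a \<times> 'a \<Rightarrow> 'a \<times> 'a) \<Rightarrow> bool" where
  "biembedding G \<rho> \<longleftrightarrow>
     embedding G \<rho> \<and>
     (\<exists>col :: ('a \<times> 'a) set \<Rightarrow> bool. \<forall>(x, y)\<in>parcs G. \<forall>c.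
        \<exists>!F. F \<in> faces G \<rho> \<and> ((x, y) \<in> F \<or> (y, x) \<in> F) \<and> col F = c)"

definition graph_automorphism :: "'a pair_pre_digraph \<Rightarrow> ('a \<Rightarrow> 'a) \<Rightarrow> bool" where
  "graph_automorphism G \<sigma> \<longleftrightarrow>
     \<sigma> permutes pverts G \<and>
     (\<forall>x\<in>pverts G. \<forall>y\<in>pverts G. (\<sigma> x, \<sigma> y) \<in> parcs G \<longleftrightarrow> (x, y) \<in> parcs G)"

definition Aut :: "'a pair_pre_digraph \<Rightarrow> ('a \<times> 'a \<Rightarrow> 'a \<times> 'a) \<Rightarrow> ('a \<Rightarrow> 'a) set" where
  "Aut G \<rho> = {\<sigma>. graph_automorphism G \<sigma> \<and>
     ((\<forall>e\<in>parcs G. map_prod \<sigma> \<sigma> (\<rho> e) = \<rho> (map_prod \<sigma> \<sigma> e)) \<or>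
      (\<forall>e\<in>parcs G. map_prod \<sigma> \<sigma> (\<rho> e) = inv \<rho> (map_prod \<sigma> \<sigma> e)))}"

definition Zmod :: "nat \<Rightarrow> int set" where
  "Zmod v = {0..<int v}"

text \<open>Like the elements of \<^const>\<open>Aut\<close>, translations are the identity off the vertex set.\<close>

definition translation :: "nat \<Rightarrow> int \<Rightarrow> int \<Rightarrow> int" where
  "translation v g x = (if x \<in> Zmod v then (x + g) mod int v else x)"

text \<open>
  The complete multipartite graph with \<open>m\<close> parts of size \<open>t\<close>, as the Cayley graph of the integers
  modulo \<open>v = m t\<close> whose parts are the cosets of the subgroup of order \<open>t\<close>, generated by \<open>m = v/t\<close>.
\<close>

definition complete_multipartite :: "nat \<Rightarrow> nat \<Rightarrow> int pair_pre_digraph" where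
  "complete_multipartite m t =
     (let v = m * t; J = (\<lambda>j. (int m * j) mod int v) ` Zmod v in
      \<lparr> pverts = Zmod v,
        parcs = {(x, y). x \<in> Zmod v \<and> y \<in> Zmod v \<and> (x - y) mod int v \<notin> J} \<rparr>)"

end

theory Submission
  imports Defs
begin

text \<open>
  Put \<open>N = n k\<close> and \<open>S = Z_v - J\<close>, which has \<open>2 N\<close> elements. A cyclic enumeration \<open>X\<close> of \<open>S\<close> gives
  the rotation \<open>(x, x + X p) \<mapsto> (x, x + X (p + 1))\<close>, which commutes with all translations. If
  \<open>X (\<nu> p) = - X p\<close>, the faces are traced by \<open>p \<mapsto> \<nu> p + 1\<close>; when \<open>\<nu>\<close> exchanges even and odd
  positions, this map preserves parity and the parity of \<open>p\<close> two-colours the faces.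

  Condition (b) asks only for face lengths that are multiples of \<open>k\<close>, so no Heffter array is needed:
  on each colour class the tracing map is chosen to be \<open>i \<mapsto> i + 2\<close> or \<open>i \<mapsto> i - 1\<close> modulo \<open>k\<close> (with \<open>k\<close>
  odd), which makes all its cycle lengths multiples of \<open>k\<close>. Exactly one cycle has length \<open>k\<close>, and
  the elements of \<open>S\<close> placed on it are fixed and have sum zero. Its faces are then the only ones of
  length \<open>k\<close>, and their corners at a vertex form a subset of \<open>Z_{2N}\<close> without dihedral symmetry; hence
  every automorphism is a translation. The other \<open>N - k\<close> pairs \<open>\<plusminus> a\<close> can be ordered and signed
  freely, which gives \<open>2 ^ (N - k) (N - k)!\<close> embeddings. This exceeds \<open>N!\<close> as soon as \<open>n\<close> is large
  compared with \<open>t\<close>, and for the finitely many remaining pairs \<open>(n, k)\<close> the claimed bound is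
  nonpositive when the constant is large.
\<close>

section \<open>Rotations of Cayley graphs\<close>

lemma funpow_commute_on:
  assumes "\<And>e. e \<in> A \<Longrightarrow> f e \<in> A" and "\<And>e. e \<in> A \<Longrightarrow> h (f e) = g (h e)" and "e \<in> A"
  shows "h ((f ^^ n) e) = (g ^^ n) (h e) \<and> (f ^^ n) e \<in> A"
  using assms(3) by (induction n) (auto simp: assms(1,2))

text \<open>On a cycle the number of points equals the first return time.\<close>

lemma funpow_fixed_card_orbit:
  assumes "x \<in> orbit f x"
  shows "(f ^^ card (orbit f x)) x = x"
proof -
  define m where "m = funpow_dist1 f x x"
  have m: "0 < m" "(f ^^ m) x = x"
    using funpow_dist1_prop[OF assms] by (auto simp: m_def)
  have "orbit f x = (\<lambda>n. (f ^^ n) x) ` {0..<m}"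
    using orbit_conv_funpow_dist1[OF assms] by (simp add: m_def)
  moreover have "inj_on (\<lambda>n. (f ^^ n) x) {0..<m}"
    using inj_on_funpow_dist1[OF assms] by (simp add: m_def)
  ultimately have "card (orbit f x) = m"
    by (simp add: card_image)
  with m show ?thesis by simp
qed

text \<open>\<open>even_M\<close> makes the parity of a position well defined modulo
  \<open>M\<close>. \<open>two_steps\<close> serves twice: it makes the graph connected, and it lets
  the action of an automorphism around 0 and its neighbours determine it everywhere.\<close>

locale cayley_rotation =
  fixes v M :: nat and G :: "int pair_pre_digraph" and X \<nu> :: "int \<Rightarrow> int"
  assumes v_pos: "0 < v" and M_pos: "0 < M" and even_M: "even M"
    and pverts_G: "pverts G = Zmod v"
    and parcs_G: "parcs G = {(x, y). x \<in> Zmod v \<and> y \<in> Zmod v \<and> (\<exists>p. (y - x) mod int v = X p)}"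
    and X_range: "0 < X p" "X p < int v"
    and X_eq_iff: "X p = X q \<longleftrightarrow> p mod int M = q mod int M"
    and X_nu: "X (\<nu> p) = (- X p) mod int v"
    and odd_nu: "odd (\<nu> p) \<longleftrightarrow> even p"
    and two_steps: "y \<in> Zmod v \<Longrightarrow> \<exists>p q. y = (X p + X q) mod int v"
begin

text \<open>Arcs are addressed by start vertex and position modulo \<open>M\<close>, so that
  rotation, reversal and face tracing act on positions by simple maps.\<close>

definition arc :: "int \<Rightarrow> int \<Rightarrow> int \<times> int" where
  "arc x p = (x, (x + X p) mod int v)"

text \<open>The chosen position is unique only modulo \<open>M\<close>, which is harmless because
  \<open>arc\<close> depends on the residue alone. Off the arcs \<open>rot\<close> is the identity,
  as \<open>permutes\<close> demands.\<close>

definition rot :: "int \<times> int \<Rightarrow> int \<times> int" where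
  "rot e = (if e \<in> parcs G
     then arc (fst e) ((SOME p. X p = (snd e - fst e) mod int v) + 1) else e)"

definition \<phi> :: "int \<Rightarrow> int" where
  "\<phi> p = \<nu> p + 1"

lemma mod_in_Zmod [simp]: "a mod int v \<in> Zmod v"
  using v_pos by (simp add: Zmod_def)

lemma Zmod_mod [simp]: "x \<in> Zmod v \<Longrightarrow> x mod int v = x"
  by (simp add: Zmod_def)

lemma X_mod_v [simp]: "X p mod int v = X p"
  using X_range[of p] by simp

lemma X_cong: "p mod int M = q mod int M \<Longrightarrow> X p = X q"
  by (simp add: X_eq_iff)

lemma arc_diff: "(snd (arc x p) - x) mod int v = X p"
  by (simp add: arc_def mod_simps)

lemma arc_in_parcs: "x \<in> Zmod v \<Longrightarrow> arc x p \<in> parcs G"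
  using arc_diff[of x p] by (auto simp: parcs_G arc_def)

lemma parcs_arcE:
  assumes "e \<in> parcs G"
  obtains x p where "x \<in> Zmod v" "e = arc x p"
proof -
  obtain x y p where e: "e = (x, y)" "x \<in> Zmod v" "y \<in> Zmod v" "(y - x) mod int v = X p"
    using assms by (auto simp: parcs_G)
  have "(x + X p) mod int v = (x + (y - x)) mod int v"
    by (metis e(4) mod_add_right_eq)
  with e have "e = arc x p" by (simp add: arc_def)
  with that e show ?thesis by blast
qed

lemma arc_eq_iff: "arc x p = arc y q \<longleftrightarrow> x = y \<and> p mod int M = q mod int M"
  by (metis X_eq_iff arc_diff arc_def fst_conv)

lemma rot_arc:
  assumes "x \<in> Zmod v"
  shows "rot (arc x p) = arc x (p + 1)"
proof -
  let ?q = "SOME q. X q = X p"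
  have "X ?q = X p" by (rule someI) simp
  then have "?q mod int M = p mod int M" by (simp add: X_eq_iff)
  then have "(?q + 1) mod int M = (p + 1) mod int M" by (rule mod_add_cong) simp
  moreover have "rot (arc x p) = arc x (?q + 1)"
    using arc_in_parcs[OF assms, of p] arc_diff[of x p] by (simp add: rot_def arc_def)
  ultimately show ?thesis by (simp add: arc_eq_iff)
qed

lemma swap_arc:
  assumes "x \<in> Zmod v"
  shows "prod.swap (arc x p) = arc ((x + X p) mod int v) (\<nu> p)"
  using assms by (simp add: arc_def X_nu mod_simps)

lemma face_step_swap: "face_step \<rho> e = \<rho> (prod.swap e)"
  by (cases e) (simp add: face_step_def)

lemma face_step_arc:
  assumes "x \<in> Zmod v"
  shows "face_step rot (arc x p) = arc ((x + X p) mod int v) (\<phi> p)"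
  by (simp add: face_step_swap swap_arc[OF assms] rot_arc \<phi>_def)

text \<open>This splits the closing of a face into two conditions: the position recurs under
  \<open>\<phi>\<close>, and the sum of the traversed values of \<open>X\<close> vanishes modulo
  \<open>v\<close>.\<close>

lemma face_step_funpow_arc:
  assumes "x \<in> Zmod v"
  shows "(face_step rot ^^ n) (arc x p) =
    arc ((x + (\<Sum>j<n. X ((\<phi> ^^ j) p))) mod int v) ((\<phi> ^^ n) p)"
  using assms by (induction n) (simp_all add: face_step_arc mod_simps algebra_simps)

section \<open>The rotation defines an embedding\<close>

lemma rot_permutes: "rot permutes parcs G"
proof -
  have "inj_on rot (parcs G)"
  proof (rule inj_onI)
    fix e e' assume "e \<in> parcs G" "e' \<in> parcs G" "rot e = rot e'"
    then obtain x p y q where "x \<in> Zmod v" "e = arc x p" "y \<in> Zmod v" "e' = arc y q"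
      "arc x (p + 1) = arc y (q + 1)"
      by (metis parcs_arcE rot_arc)
    moreover from this have "(p + 1 - 1) mod int M = (q + 1 - 1) mod int M"
      unfolding arc_eq_iff by (intro mod_diff_cong) auto
    ultimately show "e = e'" by (simp add: arc_eq_iff)
  qed
  moreover have "rot ` parcs G = parcs G"
  proof safe
    fix a b assume "(a, b) \<in> parcs G"
    then show "(a, b) \<in> rot ` parcs G"
      by (metis arc_in_parcs diff_add_cancel image_eqI parcs_arcE rot_arc)
  next
    fix x y a b assume "(x, y) = rot (a, b)" "(a, b) \<in> parcs G"
    then show "(x, y) \<in> parcs G" by (metis arc_in_parcs parcs_arcE rot_arc)
  qed
  ultimately show ?thesis
    by (intro bij_imp_permutes) (auto simp: bij_betw_def rot_def)
qed

lemma finite_parcs: "finite (parcs G)"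
  by (rule finite_subset[of _ "Zmod v \<times> Zmod v"]) (auto simp: parcs_G Zmod_def)

lemma parcs_sym: "(x, y) \<in> parcs G \<Longrightarrow> (y, x) \<in> parcs G"
  by (metis arc_in_parcs mod_in_Zmod parcs_arcE swap_arc swap_simp)

lemma pair_graph_G: "pair_graph G"
proof
  show "symmetric G" by (auto simp: symmetric_def sym_def intro: parcs_sym)
  fix e assume e: "e \<in> parcs G"
  then show "fst e \<noteq> snd e"
    using X_range by (auto simp: parcs_G) (metis less_irrefl)
  show "fst e \<in> pverts G" "snd e \<in> pverts G" using e by (auto simp: parcs_G pverts_G)
qed (auto simp: pverts_G finite_parcs Zmod_def)

text \<open>By \<open>two_steps\<close> any two vertices are joined by a path of two arcs; the
  symmetric closure used in the definition of connectedness has the same arcs.\<close>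

lemma connected_G: "Digraph_Component.connected (with_proj G)"
proof -
  let ?H = "mk_symmetric (with_proj G)"
  have H: "pverts ?H = Zmod v" "parcs ?H = parcs G"
    using parcs_sym by (auto simp: mk_symmetric_def pverts_G)
  have reach: "(x, y) \<in> rtrancl_on (Zmod v) (parcs G)" if "x \<in> Zmod v" "y \<in> Zmod v" for x y
  proof -
    obtain p q where pq: "(y - x) mod int v = (X p + X q) mod int v"
      using two_steps by (metis mod_in_Zmod)
    let ?z = "(x + X p) mod int v"
    have "(?z + X q) mod int v = (x + (X p + X q)) mod int v"
      by (simp add: mod_simps algebra_simps)
    also have "\<dots> = (x + (y - x)) mod int v" by (metis pq mod_add_right_eq)
    finally have "(?z, y) = arc ?z q" using that by (simp add: arc_def)
    then have "(?z, y) \<in> parcs G" by (simp add: arc_in_parcs)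
    moreover have "(x, ?z) \<in> parcs G"
      using arc_in_parcs[OF that(1), of p] by (simp add: arc_def)
    ultimately show ?thesis
      using that by (metis mod_in_Zmod rtrancl_on_refl rtrancl_on_into_rtrancl_on)
  qed
  have "Zmod v \<noteq> {}" using mod_in_Zmod by blast
  then show ?thesis
    by (auto simp: connected_def strongly_connected_def reachable_def H reach pverts_G)
qed

lemma finite_embeddings: "finite {\<rho>. embedding G \<rho>}"
  by (rule finite_subset[OF _ finite_permutations[OF finite_parcs]]) (auto simp: embedding_def)

lemma arc_neighbours:
  assumes "x \<in> Zmod v"
  shows "y \<in> neighbours G x \<longleftrightarrow> (\<exists>p. y = (x + X p) mod int v)"
proof
  assume "y \<in> neighbours G x"
  then obtain z p where "(x, y) = arc z p"
    unfolding neighbours_def by (metis mem_Collect_eq parcs_arcE)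
  then show "\<exists>p. y = (x + X p) mod int v" by (auto simp: arc_def)
qed (use arc_in_parcs[OF assms] in \<open>auto simp: neighbours_def arc_def\<close>)

lemma embedding_rot: "embedding G rot"
proof -
  define r where "r = (\<lambda>x y. if (x, y) \<in> parcs G then snd (rot (x, y)) else y)"
  have r_arc: "r x ((x + X p) mod int v) = (x + X (p + 1)) mod int v" if "x \<in> Zmod v" for x p
    using arc_in_parcs[OF that, of p] rot_arc[OF that, of p] by (simp add: r_def arc_def)
  have "r x permutes neighbours G x \<and> cyclic_on (r x) (neighbours G x) \<and>
    (\<forall>y\<in>neighbours G x. rot (x, y) = (x, r x y))" if x: "x \<in> Zmod v" for x
  proof (intro conjI ballI)
    have inj: "inj_on (r x) (neighbours G x)"
    proof (rule inj_onI)
      fix y z assume "y \<in> neighbours G x" "z \<in> neighbours G x" "r x y = r x z"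
      moreover from this obtain p q where "y = snd (arc x p)" "z = snd (arc x q)"
        by (auto simp: arc_neighbours[OF x] arc_def)
      ultimately have "arc x (p + 1) = arc x (q + 1)" by (simp add: arc_def r_arc[OF x])
      then have "arc x p = arc x q"
        using permutes_inj[OF rot_permutes] by (metis injD rot_arc x)
      then show "y = z" using \<open>y = snd (arc x p)\<close> \<open>z = snd (arc x q)\<close> by simp
    qed
    moreover have "r x ` neighbours G x = neighbours G x"
    proof (rule endo_inj_surj[OF _ _ inj])
      show "finite (neighbours G x)"
        by (rule finite_subset[of _ "snd ` parcs G"]) (force simp: neighbours_def finite_parcs)+
      show "r x ` neighbours G x \<subseteq> neighbours G x"
        using r_arc[OF x] by (fastforce simp: arc_neighbours[OF x])
    qed
    ultimately show "r x permutes neighbours G x"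
      by (intro bij_imp_permutes) (auto simp: bij_betw_def r_def neighbours_def)
    have pow: "(r x ^^ n) ((x + X 0) mod int v) = (x + X (int n)) mod int v" for n
      by (induction n) (simp_all add: r_arc[OF x] add.commute)
    show "cyclic_on (r x) (neighbours G x)"
      unfolding cyclic_on_def
    proof (rule bexI[of _ "(x + X 0) mod int v"])
      show "neighbours G x = orbit (r x) ((x + X 0) mod int v)"
      proof safe
        fix y assume "y \<in> neighbours G x"
        then obtain p where p: "y = (x + X p) mod int v" by (auto simp: arc_neighbours[OF x])
        \<comment> \<open>The summand \<open>M\<close> makes \<open>n\<close> positive, since
          \<open>orbit\<close> only contains points reached by at least one step.\<close>
        define n where "n = nat (p mod int M) + M"
        have "int n mod int M = p mod int M" using M_pos by (simp add: n_def)
        then have "y = (r x ^^ n) ((x + X 0) mod int v)"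
          unfolding pow p using X_cong by metis
        moreover have "0 < n" using M_pos by (simp add: n_def)
        ultimately show "y \<in> orbit (r x) ((x + X 0) mod int v)" by (auto simp: orbit_altdef)
      next
        fix y assume "y \<in> orbit (r x) ((x + X 0) mod int v)"
        then show "y \<in> neighbours G x" by (auto simp: orbit_altdef pow arc_neighbours[OF x])
      qed
    qed (auto simp: arc_neighbours[OF x])
    fix y assume "y \<in> neighbours G x"
    then obtain p where "(x, y) = arc x p" by (auto simp: arc_neighbours[OF x] arc_def)
    then show "rot (x, y) = (x, r x y)"
      using rot_arc[OF x, of p] r_arc[OF x, of p] by (simp add: arc_def)
  qed
  then show ?thesis
    unfolding embedding_def using pair_graph_G connected_G rot_permutes by (auto simp: pverts_G)
qed

section \<open>Faces and their two-colouring\<close>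

lemma inj_face_step: "inj (face_step rot)"
proof -
  have "face_step rot = rot \<circ> prod.swap" by (auto simp: face_step_swap)
  then show ?thesis using permutes_inj[OF rot_permutes] by (simp add: inj_compose)
qed

lemma face_step_in_parcs:
  assumes "e \<in> parcs G" shows "face_step rot e \<in> parcs G"
  using assms by (metis arc_in_parcs face_step_arc mod_in_Zmod parcs_arcE)

lemma face_step_funpow_in_parcs:
  assumes "e \<in> parcs G" shows "(face_step rot ^^ n) e \<in> parcs G"
  using assms by (induction n) (auto intro: face_step_in_parcs)

text \<open>An \<open>orbit\<close> begins with the first image of its base point, so a return to
  \<open>e\<close> has to be derived from injectivity on a finite set.\<close>

lemma self_in_face:
  assumes "e \<in> parcs G" shows "e \<in> orbit (face_step rot) e"
proof -
  have "finite {y. \<exists>n. y = (face_step rot ^^ n) e}"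
    by (rule finite_subset[OF _ finite_parcs]) (use face_step_funpow_in_parcs[OF assms] in auto)
  from funpow_inj_finite[OF inj_face_step this] obtain n
    where "0 < n" "(face_step rot ^^ n) e = e" by metis
  then show ?thesis unfolding orbit_altdef by (metis (mono_tags, lifting) mem_Collect_eq)
qed

lemma face_eq_orbit:
  assumes "F \<in> faces G rot" "e \<in> F"
  shows "F = orbit (face_step rot) e"
proof -
  obtain d where d: "F = orbit (face_step rot) d" "d \<in> parcs G" using assms by (auto simp: faces_def)
  show ?thesis
    using d assms self_in_face orbit_trans orbit_swap by (metis subsetI subset_antisym)
qed

text \<open>The two colour classes of faces are distinguished by the parity of the positions on them.\<close>

lemma biembedding_rot: "biembedding G rot"
proof -
  define col where "col = (\<lambda>F. \<exists>x p. x \<in> Zmod v \<and> arc x p \<in> F \<and> even p)"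
  have odd_phi: "odd (\<phi> p) \<longleftrightarrow> odd p" for p using odd_nu by (simp add: \<phi>_def)
  then have odd_phi_pow: "odd ((\<phi> ^^ n) p) \<longleftrightarrow> odd p" for n p by (induction n) auto
  have par: "even p \<longleftrightarrow> even q" if "arc x p = arc y q" for x y p q
  proof -
    have "p mod int M mod 2 = q mod int M mod 2" using that by (simp add: arc_eq_iff)
    moreover have "2 dvd int M" using even_M by simp
    ultimately have "p mod 2 = q mod 2" by (simp add: mod_mod_cancel)
    then show ?thesis by (simp add: even_iff_mod_2_eq_zero)
  qed
  have col_arc: "col (orbit (face_step rot) (arc x p)) \<longleftrightarrow> even p" if x: "x \<in> Zmod v" for x p
  proof
    assume "col (orbit (face_step rot) (arc x p))"
    then obtain y q n where "arc y q = (face_step rot ^^ n) (arc x p)" "even q"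
      by (auto simp: col_def orbit_altdef)
    then show "even p"
      using par odd_phi_pow unfolding face_step_funpow_arc[OF x] by blast
  next
    assume "even p"
    then show "col (orbit (face_step rot) (arc x p))"
      using self_in_face[OF arc_in_parcs[OF x]] x by (auto simp: col_def)
  qed
  have "\<exists>!F. F \<in> faces G rot \<and> ((x, y) \<in> F \<or> (y, x) \<in> F) \<and> col F = c"
    if xy: "(x, y) \<in> parcs G" for x y c
  proof -
    obtain p where e: "(x, y) = arc x p" "x \<in> Zmod v"
    proof (rule parcs_arcE[OF xy])
      fix z p assume "z \<in> Zmod v" "(x, y) = arc z p"
      then show ?thesis using that[of p] by (simp add: arc_def)
    qed
    have e': "(y, x) = arc y (\<nu> p)" "y \<in> Zmod v"
      using swap_arc[OF e(2), of p] e(1) by (auto simp: arc_def)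
    \<comment> \<open>The two arcs of an edge have positions \<open>p\<close> and
      \<open>\<nu> p\<close> of opposite parity, so the two faces along the edge get different
      colours.\<close>
    have c: "col (orbit (face_step rot) (x, y)) \<longleftrightarrow> even p"
      "col (orbit (face_step rot) (y, x)) \<longleftrightarrow> odd p"
      using col_arc[OF e(2), of p] col_arc[OF e'(2), of "\<nu> p"] odd_nu e e' by auto
    have f: "orbit (face_step rot) (x, y) \<in> faces G rot" "orbit (face_step rot) (y, x) \<in> faces G rot"
      using xy parcs_sym by (auto simp: faces_def)
    have u: "F = orbit (face_step rot) (x, y) \<or> F = orbit (face_step rot) (y, x)"
      if "F \<in> faces G rot" "(x, y) \<in> F \<or> (y, x) \<in> F" for F
      using that face_eq_orbit by blast
    note self = self_in_face[OF xy] self_in_face[OF parcs_sym[OF xy]]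
    show ?thesis
    proof (cases "c \<longleftrightarrow> even p")
      case True
      show ?thesis
      proof (rule ex1I)
        show "orbit (face_step rot) (x, y) \<in> faces G rot \<and>
          ((x, y) \<in> orbit (face_step rot) (x, y) \<or> (y, x) \<in> orbit (face_step rot) (x, y)) \<and>
          col (orbit (face_step rot) (x, y)) = c"
          using True c f self by blast
      qed (use True c u in blast)
    next
      case False
      show ?thesis
      proof (rule ex1I)
        show "orbit (face_step rot) (y, x) \<in> faces G rot \<and>
          ((x, y) \<in> orbit (face_step rot) (y, x) \<or> (y, x) \<in> orbit (face_step rot) (y, x)) \<and>
          col (orbit (face_step rot) (y, x)) = c"
          using False c f self by blast
      qed (use False c u in blast)
    qed
  qed
  note unique = this
  show ?thesis
    unfolding biembedding_def
    by (rule conjI[OF embedding_rot], rule exI[of _ col], intro ballI case_prodI2 allI,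
        rule unique, simp)
qed

section \<open>Automorphisms of the embedding\<close>

lemma translation_arc:
  assumes "x \<in> Zmod v"
  shows "map_prod (translation v g) (translation v g) (arc x p) = arc ((x + g) mod int v) p"
  using assms by (simp add: arc_def translation_def mod_simps algebra_simps)

lemma translation_inverse: "translation v (- g) (translation v g x) = x"
proof (cases "x \<in> Zmod v")
  case True
  have "translation v (- g) (translation v g x) = ((x + g) mod int v + - g) mod int v"
    using True by (simp add: translation_def)
  also have "\<dots> = x mod int v" by (simp only: mod_add_left_eq) simp
  finally show ?thesis using True by simp
qed (simp add: translation_def)

lemma translation_permutes: "translation v g permutes Zmod v"
proof (rule bij_imp_permutes)
  show "bij_betw (translation v g) (Zmod v) (Zmod v)"
  proof (rule bij_betw_byWitness[of _ "translation v (- g)"])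
    show "\<forall>x\<in>Zmod v. translation v (- g) (translation v g x) = x"
      by (simp add: translation_inverse)
    show "\<forall>x\<in>Zmod v. translation v g (translation v (- g) x) = x"
      using translation_inverse[of "- g"] by simp
  qed (auto simp: translation_def)
qed (simp add: translation_def)

lemma translation_in_Aut: "translation v g \<in> Aut G rot"
proof -
  have "((x + g) mod int v - (y + g) mod int v) mod int v = (x - y) mod int v" for x y
    by (simp add: mod_simps)
  then have "graph_automorphism G (translation v g)"
    unfolding graph_automorphism_def pverts_G
    by (auto simp: translation_permutes parcs_G translation_def)
  moreover have "map_prod (translation v g) (translation v g) (rot e) =
    rot (map_prod (translation v g) (translation v g) e)" if "e \<in> parcs G" for e
    using that by (metis mod_in_Zmod parcs_arcE rot_arc translation_arc)
  ultimately show ?thesis by (simp add: Aut_def)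
qed

lemma inv_rot_arc: "x \<in> Zmod v \<Longrightarrow> inv rot (arc x p) = arc x (p - 1)"
  using rot_arc[of x "p - 1"] permutes_inj[OF rot_permutes] by (simp add: inv_f_eq)

text \<open>
  \<open>Q\<close> selects the corners at a vertex that lie on faces of length dividing \<open>K\<close>; an automorphism
  fixing the vertex up to translation acts on these corners by a dihedral symmetry.
\<close>

lemma Aut_eq_translations:
  fixes Q :: "int \<Rightarrow> bool" and K :: nat
  assumes period: "\<And>x p. x \<in> Zmod v \<Longrightarrow> (face_step rot ^^ K) (arc x p) = arc x p \<longleftrightarrow> Q p"
    and no_rotation: "\<And>l. (\<And>p. Q p \<longleftrightarrow> Q (p + l)) \<Longrightarrow> l mod int M = 0"
    and no_reflection: "\<And>c. \<not> (\<forall>p. Q p \<longleftrightarrow> Q (c - p))"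
  shows "Aut G rot = translation v ` Zmod v"
proof
  show "translation v ` Zmod v \<subseteq> Aut G rot" by (auto simp: translation_in_Aut)
  show "Aut G rot \<subseteq> translation v ` Zmod v"
  proof
    fix \<sigma> assume \<sigma>: "\<sigma> \<in> Aut G rot"
    then have perm: "\<sigma> permutes Zmod v" and adj: "\<And>x y. x \<in> Zmod v \<Longrightarrow> y \<in> Zmod v \<Longrightarrow>
        (\<sigma> x, \<sigma> y) \<in> parcs G \<longleftrightarrow> (x, y) \<in> parcs G"
      by (auto simp: Aut_def graph_automorphism_def pverts_G)
    let ?h = "map_prod \<sigma> \<sigma>"
    define g where "g = \<sigma> 0"
    have zero: "0 \<in> Zmod v" using v_pos by (simp add: Zmod_def)
    have \<sigma>_Zmod: "\<sigma> x \<in> Zmod v" if "x \<in> Zmod v" for x using permutes_in_image[OF perm] that by simp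
    then have g: "g \<in> Zmod v" using zero by (simp add: g_def)
    have h_parcs: "?h e \<in> parcs G" if "e \<in> parcs G" for e
      using that adj by (cases e) (auto simp: parcs_G)
    have h_inj: "inj ?h" using permutes_inj[OF perm] by (simp add: prod.inj_map)
    have h_arc: "\<exists>q. ?h (arc x p) = arc (\<sigma> x) q" if "x \<in> Zmod v" for x p
    proof -
      have "?h (arc x p) \<in> parcs G" by (simp add: h_parcs arc_in_parcs that)
      then show ?thesis by (metis arc_def fst_conv fst_map_prod parcs_arcE)
    qed
    \<comment> \<open>The offset \<open>l\<close> describes the action on all arcs at 0: position
      \<open>p\<close> goes to \<open>p + l\<close> if \<open>\<sigma>\<close> commutes with the
      rotation, and to \<open>l - p\<close> if it inverts it.\<close>
    obtain l where l: "?h (arc 0 0) = arc g l" using h_arc[OF zero] g_def by blast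
    have shift: "(y + 1) mod int M = (z + 1) mod int M" if "y mod int M = z mod int M" for y z
      using that by (intro mod_add_cong) auto
    consider (pos) "\<And>e. e \<in> parcs G \<Longrightarrow> ?h (rot e) = rot (?h e)"
      | (neg) "\<And>e. e \<in> parcs G \<Longrightarrow> ?h (rot e) = inv rot (?h e)"
      using \<sigma> by (auto simp: Aut_def)
    then show "\<sigma> \<in> translation v ` Zmod v"
    proof cases
      case pos
      have h_pow: "?h (arc x (p + int n)) = arc (\<sigma> x) (q + int n)"
        if "x \<in> Zmod v" "?h (arc x p) = arc (\<sigma> x) q" for x p q n
      proof (induction n)
        case (Suc n)
        show ?case
          using pos[OF arc_in_parcs[OF that(1), of "p + int n"]] Suc
          by (simp add: rot_arc that(1) \<sigma>_Zmod algebra_simps)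
      qed (use that in simp)
      \<comment> \<open>The difference of positions is replaced by its residue modulo
        \<open>M\<close>, so that nonnegative iterates of \<open>rot\<close> reach every
        position.\<close>
      have h_pow': "?h (arc x p') = arc (\<sigma> x) (q + (p' - p))"
        if "x \<in> Zmod v" "?h (arc x p) = arc (\<sigma> x) q" for x p p' q
      proof -
        let ?n = "nat ((p' - p) mod int M)"
        have "0 \<le> (p' - p) mod int M" using M_pos by simp
        then have n: "int ?n = (p' - p) mod int M" by (rule nat_0_le)
        have "(p + int ?n) mod int M = p' mod int M"
          "(q + int ?n) mod int M = (q + (p' - p)) mod int M"
          unfolding n by (simp_all add: mod_simps)
        with h_pow[OF that, of ?n] show ?thesis by (metis arc_eq_iff)
      qed
      have h0: "?h (arc 0 p) = arc g (p + l)" for p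
        using h_pow'[OF zero, of 0 l p] l by (simp add: g_def add.commute)
      have "?h (face_step rot e) = face_step rot (?h e)" if "e \<in> parcs G" for e
      proof -
        have "prod.swap e \<in> parcs G" using that parcs_sym by (cases e) auto
        then have "?h (rot (prod.swap e)) = rot (?h (prod.swap e))" by (rule pos)
        then show ?thesis by (cases e) (simp add: face_step_def)
      qed
      then have h_face: "?h ((face_step rot ^^ K) e) = (face_step rot ^^ K) (?h e)"
        if "e \<in> parcs G" for e
        using funpow_commute_on[of "parcs G" "face_step rot" ?h "face_step rot" e K]
          face_step_in_parcs that by blast
      \<comment> \<open>Being fixed by \<open>K\<close> face steps is preserved by
        \<open>?h\<close>, which commutes with face tracing.\<close>
      have "Q p \<longleftrightarrow> Q (p + l)" for p
        using period[OF zero, of p] period[OF g, of "p + l"] h_face[OF arc_in_parcs[OF zero, of p]]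
          h0[of p] h_inj by (metis injD)
      then have "l mod int M = 0" by (rule no_rotation)
      then have h0': "?h (arc 0 p) = arc g p" for p
        unfolding h0 arc_eq_iff by (metis add.right_neutral mod_add_right_eq)
      have \<sigma>_X: "\<sigma> (X p) = (g + X p) mod int v" for p
        using h0'[of p] by (simp add: arc_def)
      have "\<sigma> y = translation v g y" if y: "y \<in> Zmod v" for y
      proof -
        obtain p q where pq: "y = (X p + X q) mod int v" using two_steps[OF y] by blast
        have Xp: "X p \<in> Zmod v" using X_range[of p] by (simp add: Zmod_def)
        \<comment> \<open>The arc from the neighbour \<open>X p\<close> back to 0 has position
          \<open>\<nu> p\<close>, and so has its image, the reverse of \<open>arc g p\<close>. Hence
          the offset is zero at every neighbour of 0 as well, and \<open>two_steps\<close> reaches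
          all remaining vertices.\<close>
        have "arc (X p) (\<nu> p) = prod.swap (arc 0 p)" by (simp add: swap_arc zero)
        then have "?h (arc (X p) (\<nu> p)) = prod.swap (arc g p)"
          using h0'[of p] by (simp add: arc_def)
        then have "?h (arc (X p) (\<nu> p)) = arc (\<sigma> (X p)) (\<nu> p)"
          by (simp add: swap_arc g \<sigma>_X)
        from h_pow'[OF Xp this, of q] have "?h (arc (X p) q) = arc (\<sigma> (X p)) q" by simp
        then have "\<sigma> y = (\<sigma> (X p) + X q) mod int v" by (simp add: arc_def pq)
        then show ?thesis using y by (simp add: \<sigma>_X pq translation_def mod_simps algebra_simps)
      qed
      moreover have "\<sigma> y = translation v g y" if "y \<notin> Zmod v" for y
        using that permutes_not_in[OF perm] by (simp add: translation_def)
      ultimately have "\<sigma> = translation v g" by blast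
      then show ?thesis using g by blast
    next
      case neg
      have h_pow: "?h (arc 0 (int n)) = arc g (l - int n)" for n
      proof (induction n)
        case (Suc n)
        show ?case
          using neg[OF arc_in_parcs[OF zero, of "int n"]] Suc
          by (simp add: rot_arc inv_rot_arc zero g algebra_simps)
      qed (use l in simp)
      have h0: "?h (arc 0 p) = arc g (l - p)" for p
      proof -
        let ?n = "nat (p mod int M)"
        have "int ?n mod int M = p mod int M" "(l - int ?n) mod int M = (l - p) mod int M"
          using M_pos by (simp_all add: mod_simps)
        with h_pow[of ?n] show ?thesis by (metis arc_eq_iff)
      qed
      let ?f = "face_step rot"
      text \<open>\<open>prod.swap \<circ> ?h\<close> conjugates the face permutation to its inverse.\<close>
      have rev: "?f (prod.swap (?h (?f e))) = prod.swap (?h e)" if "e \<in> parcs G" for e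
      proof -
        have "prod.swap e \<in> parcs G" using that parcs_sym by (cases e) auto
        then have "?h (rot (prod.swap e)) = inv rot (?h (prod.swap e))" by (rule neg)
        then have "rot (?h (rot (prod.swap e))) = ?h (prod.swap e)"
          using permutes_inverses(1)[OF rot_permutes] by simp
        then show ?thesis by (cases e) (simp add: face_step_swap)
      qed
      have rev_pow: "(?f ^^ n) (prod.swap (?h ((?f ^^ n) e))) = prod.swap (?h e)"
        if "e \<in> parcs G" for e n
      proof (induction n)
        case (Suc n)
        have "(?f ^^ Suc n) (prod.swap (?h ((?f ^^ Suc n) e))) =
          (?f ^^ n) (?f (prod.swap (?h (?f ((?f ^^ n) e)))))"
          by (simp add: funpow_swap1)
        then show ?case using rev[OF face_step_funpow_in_parcs[OF that, of n]] Suc by simp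
      qed simp
      \<comment> \<open>The reversed image \<open>?c\<close> has the same period as
        \<open>?e\<close>. One more face step undoes the reversal and moves to the next position,
        hence the summand 1.\<close>
      have "Q p \<longleftrightarrow> Q (l + 1 - p)" for p
      proof -
        let ?e = "arc 0 p" and ?c = "prod.swap (arc g (l - p))"
        have e: "?e \<in> parcs G" by (simp add: arc_in_parcs zero)
        have pow_inj: "(?f ^^ n) a = (?f ^^ n) b \<longleftrightarrow> a = b" for a b n
          using inj_fn[OF inj_face_step, of n] by (auto dest: injD)
        have "(?f ^^ K) ?e = ?e \<longleftrightarrow> prod.swap (?h ((?f ^^ K) ?e)) = prod.swap (?h ?e)"
          using h_inj by (metis injD swap_swap)
        also have "\<dots> \<longleftrightarrow> (?f ^^ K) ?c = ?c"
          using rev_pow[OF e, of K] h0[of p] pow_inj by metis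
        also have "\<dots> \<longleftrightarrow> (?f ^^ K) (?f ?c) = ?f ?c"
          using pow_inj[of 1] by (simp flip: funpow_swap1)
        also have "?f ?c = arc g (l + 1 - p)"
          by (simp add: face_step_swap rot_arc g algebra_simps)
        finally show ?thesis using period zero g by simp
      qed
      then show ?thesis using no_reflection by blast
    qed
  qed
qed

end

section \<open>A rotation with an asymmetric set of short faces\<close>

text \<open>\<open>R\<close> is a rank. Without a drop it has risen by \<open>d * n\<close> after
  \<open>n\<close> steps; with a drop, the at most \<open>n - 1\<close> rising steps cannot make up
  for the loss of at least \<open>d * n\<close>. Either way the start is not reached again.\<close>

lemma no_periodic_point:
  fixes R :: "'a \<Rightarrow> int"
  assumes step: "\<And>y. y \<in> Y \<Longrightarrow> g y \<in> Y \<and> (R (g y) = R y + d \<or> R (g y) \<le> R y - d * int n)"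
    and "0 < d" "0 < n" "y \<in> Y"
  shows "(g ^^ n) y \<noteq> y"
proof -
  define D where "D = d * int n"
  have D: "0 < D" using \<open>0 < d\<close> \<open>0 < n\<close> by (simp add: D_def)
  \<comment> \<open>The second alternative records that a drop has occurred: \<open>D\<close> is the
    loss and \<open>d\<close> the rise missed in that step.\<close>
  have "(g ^^ j) y \<in> Y \<and>
      (R ((g ^^ j) y) = R y + d * int j \<or> R ((g ^^ j) y) \<le> R y + d * int j - d - D)"
    if "j \<le> n" for j
    using that
  proof (induction j)
    case (Suc j)
    then have Y: "(g ^^ j) y \<in> Y" by simp
    have "d * int (Suc j) = d * int j + d" by (simp add: algebra_simps)
    moreover have "d * int j \<ge> 0" using \<open>0 < d\<close> by simp
    ultimately show ?case using step[OF Y, folded D_def] Suc D \<open>0 < d\<close> by auto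
  qed (use \<open>y \<in> Y\<close> in simp)
  from this[of n] show ?thesis using \<open>0 < d\<close> D by (auto simp: D_def)
qed

lemma funpow_left_comm: "(f ^^ m) ((f ^^ n) x) = (f ^^ n) ((f ^^ m) x)"
  using fun_cong[OF funpow_add[of m n f], of x] fun_cong[OF funpow_add[of n m f], of x]
  by (simp add: add.commute)

text \<open>A return after \<open>n\<close> steps gives \<open>n * d\<close> congruent to 0 modulo
  \<open>k\<close>, and \<open>d\<close> cancels.\<close>

lemma dvd_period:
  fixes g :: "int \<Rightarrow> int"
  assumes "\<And>y. y \<in> Y \<Longrightarrow> g y \<in> Y \<and> [g y = y + d] (mod k)" and "coprime d k"
    and "y \<in> Y" "(g ^^ n) y = y"
  shows "k dvd int n"
proof -
  have "(g ^^ j) y \<in> Y \<and> [(g ^^ j) y = y + int j * d] (mod k)" for j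
  proof (induction j)
    case (Suc j)
    then have "[g ((g ^^ j) y) = (g ^^ j) y + d] (mod k)" using assms(1) by blast
    also have "[(g ^^ j) y + d = (y + int j * d) + d] (mod k)" using Suc by (simp add: cong_add)
    finally show ?case using Suc assms(1) by (simp add: algebra_simps)
  qed (use assms in simp)
  from this[of n] have "[y + 0 = y + int n * d] (mod k)" using assms(4) by simp
  then have "k dvd int n * d" by (metis cong_0_iff cong_add_lcancel cong_sym_eq)
  then show ?thesis using assms(2) by (simp add: coprime_commute coprime_dvd_mult_left_iff)
qed

text \<open>\<open>b\<close> takes one element from each pair of opposite differences.
  \<open>b_sum\<close> closes the faces along the \<open>k\<close>-cycle, and \<open>N_ge\<close>
  keeps the exceptional points, which lie below \<open>5 * k + 2\<close>, away from the wrap-around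
  at \<open>N\<close>.\<close>

locale filling =
  fixes v N k :: nat and G :: "int pair_pre_digraph" and b :: "int \<Rightarrow> int"
  assumes k_ge: "3 \<le> k" and odd_k: "odd k" and odd_N: "odd N" and k_dvd_N: "k dvd N"
    and N_ge: "16 * k \<le> N" and v_pos: "0 < v"
    and pverts_G: "pverts G = Zmod v"
    and parcs_G: "parcs G = {(x, y). x \<in> Zmod v \<and> y \<in> Zmod v \<and>
      (\<exists>i\<in>{0..<int N}. (y - x) mod int v = b i \<or> (y - x) mod int v = (- b i) mod int v)}"
    and b_range: "i \<in> {0..<int N} \<Longrightarrow> 0 < b i \<and> b i < int v"
    and b_inj: "inj_on b {0..<int N}"
    and b_neg: "i \<in> {0..<int N} \<Longrightarrow> j \<in> {0..<int N} \<Longrightarrow> b i + b j \<noteq> int v"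
    and b_sum: "((\<Sum>j<k - 1. b (2 + 2 * int j)) + b (5 * int k)) mod int v = 0"
    and two_steps_b: "y \<in> Zmod v \<Longrightarrow> \<exists>s\<in>Zmod v. \<exists>s'\<in>Zmod v. (0, s) \<in> parcs G \<and> (0, s') \<in> parcs G \<and> y = (s + s') mod int v"
begin

text \<open>
  \<open>\<pi>\<close> is the successor modulo \<open>N\<close> with four values permuted among points congruent modulo \<open>k\<close>, so that
  \<open>i \<mapsto> \<pi> i + 1\<close> has the \<open>k\<close>-cycle \<open>2, 4, \<dots>, 2 k - 2, 5 k\<close>; \<open>\<kappa>\<close> is its inverse.
\<close>

definition \<pi> :: "int \<Rightarrow> int" where
  "\<pi> i = (if i = 2 * int k - 2 then 5 * int k - 1 else if i = 5 * int k then 1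
     else if i = 5 * int k - 2 then 2 * int k - 1 else if i = 0 then 5 * int k + 1
     else if i = int N - 1 then 0 else i + 1)"

definition \<kappa> :: "int \<Rightarrow> int" where
  "\<kappa> j = (if j = 5 * int k - 1 then 2 * int k - 2 else if j = 1 then 5 * int k
     else if j = 2 * int k - 1 then 5 * int k - 2 else if j = 5 * int k + 1 then 0
     else if j = 0 then int N - 1 else j - 1)"

text \<open>The value at position \<open>2 * i\<close> has its negative at
  \<open>2 * \<pi> i + 1\<close>. Face tracing therefore acts as \<open>\<tau>\<close> on the
  indices of even positions and as \<open>\<kappa>\<close> on those of odd ones.\<close>

definition X :: "int \<Rightarrow> int" where
  "X p = (let i = p mod (2 * int N) div 2
     in if even p then b i else (- b (\<kappa> i)) mod int v)"

definition \<nu> :: "int \<Rightarrow> int" where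
  "\<nu> p = (let i = p mod (2 * int N) div 2 in if even p then 2 * \<pi> i + 1 else 2 * \<kappa> i)"

definition \<tau> :: "int \<Rightarrow> int" where
  "\<tau> i = (\<pi> i + 1) mod int N"

lemma k_ge': "3 \<le> int k" and N_ge': "16 * int k \<le> int N"
  using k_ge N_ge by simp_all

lemma \<pi>_range: "i \<in> {0..<int N} \<Longrightarrow> \<pi> i \<in> {0..<int N}"
  using k_ge' N_ge' by (auto simp: \<pi>_def)

lemma \<kappa>_range: "i \<in> {0..<int N} \<Longrightarrow> \<kappa> i \<in> {0..<int N}"
  using k_ge' N_ge' by (auto simp: \<kappa>_def)

lemma \<kappa>_\<pi>: "i \<in> {0..<int N} \<Longrightarrow> \<kappa> (\<pi> i) = i"
  using k_ge' N_ge' by (auto simp: \<kappa>_def \<pi>_def)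

lemma \<pi>_\<kappa>: "i \<in> {0..<int N} \<Longrightarrow> \<pi> (\<kappa> i) = i"
  using k_ge' N_ge' by (auto simp: \<kappa>_def \<pi>_def)

lemma \<tau>_eq:
  assumes "i \<in> {0..<int N}"
  shows "\<tau> i = (if i = 2 * int k - 2 then 5 * int k else if i = 5 * int k then 2
     else if i = 5 * int k - 2 then 2 * int k else if i = 0 then 5 * int k + 2
     else if i = int N - 1 then 1 else if i = int N - 2 then 0 else i + 2)"
  using assms k_ge' N_ge' by (auto simp: \<tau>_def \<pi>_def)

lemma \<tau>_range: "\<tau> i \<in> {0..<int N}"
  using k_ge' N_ge' by (auto simp: \<tau>_def)

lemma half_range: "p mod (2 * int N) div 2 \<in> {0..<int N}"
proof -
  have "0 \<le> p mod (2 * int N)" "p mod (2 * int N) < 2 * int N" using N_ge' k_ge' by simp_all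
  then show ?thesis by auto
qed

lemma even_mod [simp]: "even (p mod (2 * int N)) \<longleftrightarrow> even p"
  by (simp add: dvd_mod_iff)

lemma mod_even: "i \<in> {0..<int N} \<Longrightarrow> 2 * i mod (2 * int N) div 2 = i"
  and mod_odd: "i \<in> {0..<int N} \<Longrightarrow> (2 * i + 1) mod (2 * int N) div 2 = i"
  by simp_all

lemma X_even: "i \<in> {0..<int N} \<Longrightarrow> X (2 * i) = b i"
  unfolding X_def Let_def by (subst mod_even) simp_all

lemma X_odd: "i \<in> {0..<int N} \<Longrightarrow> X (2 * i + 1) = (- b (\<kappa> i)) mod int v"
  unfolding X_def Let_def by (subst mod_odd) simp_all

lemma \<nu>_even: "i \<in> {0..<int N} \<Longrightarrow> \<nu> (2 * i) = 2 * \<pi> i + 1"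
  unfolding \<nu>_def Let_def by (subst mod_even) simp_all

lemma \<nu>_odd: "i \<in> {0..<int N} \<Longrightarrow> \<nu> (2 * i + 1) = 2 * \<kappa> i"
  unfolding \<nu>_def Let_def by (subst mod_odd) simp_all

lemma X_mod: "X (p mod (2 * int N)) = X p" and \<nu>_mod: "\<nu> (p mod (2 * int N)) = \<nu> p"
  by (simp_all add: X_def \<nu>_def)

lemma residue_cases:
  obtains i where "i \<in> {0..<int N}" "p mod (2 * int N) = 2 * i" "even p"
  | i where "i \<in> {0..<int N}" "p mod (2 * int N) = 2 * i + 1" "odd p"
proof -
  let ?i = "p mod (2 * int N) div 2"
  show thesis
  proof (cases "even p")
    case True
    then have "p mod (2 * int N) = 2 * ?i" by simp
    then show thesis using that(1) half_range True by blast
  next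
    case False
    then have "p mod (2 * int N) = 2 * ?i + 1" by simp
    then show thesis using that(2) half_range False by blast
  qed
qed

lemma X_eqs:
  "i \<in> {0..<int N} \<Longrightarrow> p mod (2 * int N) = 2 * i \<Longrightarrow> X p = b i"
  "i \<in> {0..<int N} \<Longrightarrow> p mod (2 * int N) = 2 * i + 1 \<Longrightarrow> X p = int v - b (\<kappa> i)"
proof -
  assume i: "i \<in> {0..<int N}"
  { assume "p mod (2 * int N) = 2 * i"
    then show "X p = b i" using X_even[OF i] X_mod by metis }
  { assume "p mod (2 * int N) = 2 * i + 1"
    then have "X p = (- b (\<kappa> i)) mod int v" using X_odd[OF i] X_mod by metis
    then show "X p = int v - b (\<kappa> i)" using b_range[OF \<kappa>_range[OF i]] by (simp add: zmod_zminus1_eq_if) }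
qed

lemma b_eq_iff: "i \<in> {0..<int N} \<Longrightarrow> j \<in> {0..<int N} \<Longrightarrow> b i = b j \<longleftrightarrow> i = j"
  using b_inj by (simp add: inj_on_eq_iff)

lemma \<kappa>_eq_iff: "i \<in> {0..<int N} \<Longrightarrow> j \<in> {0..<int N} \<Longrightarrow> \<kappa> i = \<kappa> j \<longleftrightarrow> i = j"
  using \<pi>_\<kappa> by metis

sublocale cayley_rotation v "2 * N" G X \<nu>
proof
  show "0 < v" "0 < 2 * N" "even (2 * N)" "pverts G = Zmod v"
    using v_pos N_ge k_ge pverts_G by simp_all
  have neg_b: "(- b i) mod int v = int v - b i" if "i \<in> {0..<int N}" for i
    using b_range[OF that] by (simp add: zmod_zminus1_eq_if)
  have b_of_X: "\<exists>p. X p = b i" "\<exists>p. X p = (- b i) mod int v" if "i \<in> {0..<int N}" for i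
    using X_even[OF that] X_odd[OF \<pi>_range[OF that]] \<kappa>_\<pi>[OF that] by metis+
  have X_of_b: "\<exists>i\<in>{0..<int N}. X p = b i \<or> X p = (- b i) mod int v" for p
    using half_range[of p] \<kappa>_range[OF half_range[of p]] unfolding X_def Let_def
    by (cases "even p") (simp_all only: if_True if_False simp_thms, blast+)
  show parcs: "parcs G = {(x, y). x \<in> Zmod v \<and> y \<in> Zmod v \<and> (\<exists>p. (y - x) mod int v = X p)}"
    unfolding parcs_G using X_of_b b_of_X by (auto; metis)
  fix p q :: int
  show "0 < X p" "X p < int v"
    using X_of_b[of p] neg_b b_range by fastforce+
  show "odd (\<nu> p) \<longleftrightarrow> even p" by (simp add: \<nu>_def Let_def)
  show "X p = X q \<longleftrightarrow> p mod int (2 * N) = q mod int (2 * N)"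
  proof -
    \<comment> \<open>By \<open>b_neg\<close> no chosen difference is the negative of another, so
      positions of opposite parity carry different values.\<close>
    have ne: "b i \<noteq> int v - b j" "int v - b j \<noteq> b i"
      if "i \<in> {0..<int N}" "j \<in> {0..<int N}" for i j using b_neg[OF that] by auto
    have "X p = X q \<longleftrightarrow> p mod (2 * int N) = q mod (2 * int N)"
    proof (cases p rule: residue_cases)
      case p: (1 i)
      show ?thesis
      proof (cases q rule: residue_cases)
        case q: (1 j)
        show ?thesis
          unfolding X_eqs(1)[OF p(1,2)] X_eqs(1)[OF q(1,2)] b_eq_iff[OF p(1) q(1)] p(2) q(2) by simp
      next
        case q: (2 j)
        have "2 * i \<noteq> 2 * j + 1" by presburger
        then show ?thesis
          unfolding X_eqs(1)[OF p(1,2)] X_eqs(2)[OF q(1,2)] p(2) q(2)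
          using ne(1)[OF p(1) \<kappa>_range[OF q(1)]] by blast
      qed
    next
      case p: (2 i)
      show ?thesis
      proof (cases q rule: residue_cases)
        case q: (1 j)
        have "2 * i + 1 \<noteq> 2 * j" by presburger
        then show ?thesis
          unfolding X_eqs(2)[OF p(1,2)] X_eqs(1)[OF q(1,2)] p(2) q(2)
          using ne(2)[OF q(1) \<kappa>_range[OF p(1)]] by blast
      next
        case q: (2 j)
        show ?thesis
          unfolding X_eqs(2)[OF p(1,2)] X_eqs(2)[OF q(1,2)] p(2) q(2)
          using b_eq_iff[OF \<kappa>_range[OF p(1)] \<kappa>_range[OF q(1)]] \<kappa>_eq_iff[OF p(1) q(1)] by auto
      qed
    qed
    then show ?thesis by simp
  qed
  show "X (\<nu> p) = (- X p) mod int v"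
  proof (cases p rule: residue_cases)
    case (1 i)
    then have "\<nu> p = 2 * \<pi> i + 1" using \<nu>_even \<nu>_mod by metis
    then have "X (\<nu> p) = (- b i) mod int v" using X_odd[OF \<pi>_range] \<kappa>_\<pi> 1(1) by metis
    then show ?thesis using X_eqs(1)[OF 1(1,2)] by simp
  next
    case (2 i)
    then have "\<nu> p = 2 * \<kappa> i" using \<nu>_odd \<nu>_mod by metis
    then have "X (\<nu> p) = b (\<kappa> i)" using X_even[OF \<kappa>_range] 2(1) by metis
    moreover have "b (\<kappa> i) mod int v = b (\<kappa> i)" using b_range[OF \<kappa>_range[OF 2(1)]] by simp
    ultimately show ?thesis using X_eqs(2)[OF 2(1,2)] by (simp add: mod_simps)
  qed
  fix y assume "y \<in> Zmod v"
  then obtain s s' where s: "s \<in> Zmod v" "s' \<in> Zmod v" "(0, s) \<in> parcs G" "(0, s') \<in> parcs G"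
    "y = (s + s') mod int v" using two_steps_b by blast
  have "\<exists>p. s = X p" if "(0, s) \<in> parcs G" "s \<in> Zmod v" for s
    using that unfolding parcs by (auto simp: Zmod_def)
  then show "\<exists>p q. y = (X p + X q) mod int v" using s by metis
qed

section \<open>Cycles of the tracing maps and the faces of length \<open>k\<close>\<close>

definition special :: "int \<Rightarrow> bool" where
  "special i \<longleftrightarrow> even i \<and> 2 \<le> i \<and> i \<le> 2 * int k - 2 \<or> i = 5 * int k"

definition special_corner :: "int \<Rightarrow> bool" where
  "special_corner p \<longleftrightarrow> even p \<and> special (p mod (2 * int N) div 2)"

lemma \<phi>_even:
  assumes "i \<in> {0..<int N}" "p mod (2 * int N) = 2 * i"
  shows "\<phi> p mod (2 * int N) = 2 * \<tau> i"
proof -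
  have "\<nu> p = 2 * \<pi> i + 1" using assms \<nu>_even \<nu>_mod by metis
  then have "\<phi> p = 2 * (\<pi> i + 1)" by (simp add: \<phi>_def)
  then show ?thesis by (simp only: \<tau>_def mod_mult_mult1)
qed

lemma \<phi>_odd:
  assumes "i \<in> {0..<int N}" "p mod (2 * int N) = 2 * i + 1"
  shows "\<phi> p mod (2 * int N) = 2 * \<kappa> i + 1"
proof -
  have "\<nu> p = 2 * \<kappa> i" using assms \<nu>_odd \<nu>_mod by metis
  then show ?thesis using \<kappa>_range[OF assms(1)] by (simp add: \<phi>_def)
qed

lemma \<phi>_pow_even:
  assumes "i \<in> {0..<int N}" "p mod (2 * int N) = 2 * i"
  shows "(\<phi> ^^ n) p mod (2 * int N) = 2 * (\<tau> ^^ n) i \<and> (\<tau> ^^ n) i \<in> {0..<int N}"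
  using assms by (induction n) (auto simp: \<phi>_even \<tau>_range simp del: atLeastLessThan_iff)

lemma \<phi>_pow_odd:
  assumes "i \<in> {0..<int N}" "p mod (2 * int N) = 2 * i + 1"
  shows "(\<phi> ^^ n) p mod (2 * int N) = 2 * (\<kappa> ^^ n) i + 1 \<and> (\<kappa> ^^ n) i \<in> {0..<int N}"
  using assms by (induction n) (auto simp: \<phi>_odd \<kappa>_range simp del: atLeastLessThan_iff)

text \<open>Apart from the \<open>k\<close>-cycle, \<open>\<tau>\<close> has two cycles, moving by
  two: 0, \<open>5 k + 2\<close>, ..., \<open>N - 2\<close>, and \<open>2 k\<close>, ...,
  \<open>N - 1\<close>, 1, ..., \<open>5 k - 2\<close>. Both are too long for period
  \<open>k\<close>, which a rank function detects.\<close>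

lemma \<tau>_periodic_special:
  assumes "i \<in> {0..<int N}" "(\<tau> ^^ k) i = i"
  shows "special i"
proof (rule ccontr)
  assume ns: "\<not> special i"
  \<comment> \<open>Adding \<open>N\<close> to 0 and to the odd points below \<open>5 k\<close>
    makes them continue the runs ending in \<open>N - 2\<close> and \<open>N - 1\<close>. The only
    drops are then from 0 to \<open>5 k + 2\<close> and from \<open>5 k - 2\<close> to
    \<open>2 k\<close>.\<close>
  define R where "R = (\<lambda>i. if i = 0 \<or> odd i \<and> i < 5 * int k then int N + i else i)"
  define Y where "Y = {i \<in> {0..<int N}. \<not> special i}"
  have "(\<tau> ^^ k) i \<noteq> i"
  proof (rule no_periodic_point[where R = R and d = 2 and Y = Y])
    show "i \<in> Y" using ns assms by (simp add: Y_def)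
    fix y assume "y \<in> Y"
    then have y: "y \<in> {0..<int N}" "\<not> special y" by (auto simp: Y_def)
    have ods: "odd (int k)" "odd (int N)" using odd_k odd_N by simp_all
    have "\<not> special (\<tau> y)"
      using y ods k_ge' N_ge' unfolding special_def \<tau>_eq[OF y(1)] atLeastLessThan_iff
      by (auto split: if_splits; presburger)
    moreover have "R (\<tau> y) = R y + 2 \<or> R (\<tau> y) \<le> R y - 2 * int k"
      using y ods k_ge' N_ge' unfolding special_def \<tau>_eq[OF y(1)] R_def atLeastLessThan_iff
      by (auto split: if_splits; presburger)
    ultimately show "\<tau> y \<in> Y \<and> (R (\<tau> y) = R y + 2 \<or> R (\<tau> y) \<le> R y - 2 * int k)"
      using \<tau>_range by (simp add: Y_def)
  qed (use k_ge in auto)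
  with assms show False by simp
qed

text \<open>The cycles of \<open>\<kappa>\<close> are 0, \<open>N - 1\<close>, ...,
  \<open>5 k + 1\<close>; then \<open>5 k\<close>, \<open>5 k - 1\<close>, \<open>2 k - 2\<close>,
  ..., 1; then \<open>5 k - 2\<close>, ..., \<open>2 k - 1\<close>. The rank is adjusted at 0,
  \<open>5 k - 1\<close> and \<open>5 k\<close> so that it rises by one along each of them except
  for one drop of at least \<open>k\<close>.\<close>

lemma \<kappa>_not_periodic:
  assumes "i \<in> {0..<int N}"
  shows "(\<kappa> ^^ k) i \<noteq> i"
proof (rule no_periodic_point[where d = 1 and Y = "{0..<int N}" and
      R = "\<lambda>i. if i = 0 then - int N else if i = 5 * int k - 1 \<or> i = 5 * int k then 3 * int k - i else - i"])
  fix y assume y: "y \<in> {0..<int N}"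
  then show "\<kappa> y \<in> {0..<int N} \<and>
    ((if \<kappa> y = 0 then - int N else if \<kappa> y = 5 * int k - 1 \<or> \<kappa> y = 5 * int k then 3 * int k - \<kappa> y else - \<kappa> y) =
     (if y = 0 then - int N else if y = 5 * int k - 1 \<or> y = 5 * int k then 3 * int k - y else - y) + 1 \<or>
     (if \<kappa> y = 0 then - int N else if \<kappa> y = 5 * int k - 1 \<or> \<kappa> y = 5 * int k then 3 * int k - \<kappa> y else - \<kappa> y) \<le>
     (if y = 0 then - int N else if y = 5 * int k - 1 \<or> y = 5 * int k then 3 * int k - y else - y) - 1 * int k)"
    using k_ge' N_ge' \<kappa>_range[OF y] unfolding \<kappa>_def atLeastLessThan_iff by auto
qed (use assms k_ge in auto)

lemma int_k_dvd_N: "int k dvd int N"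
  using k_dvd_N by simp

text \<open>The exceptional values are exchanged within residue classes modulo \<open>k\<close>, and
  the wrap-around respects these because \<open>k\<close> divides \<open>N\<close>.\<close>

lemma \<tau>_cong: "i \<in> {0..<int N} \<Longrightarrow> [\<tau> i = i + 2] (mod int k)"
  using int_k_dvd_N by (auto simp: \<tau>_eq cong_iff_dvd_diff dvd_diff)

lemma \<kappa>_cong: "i \<in> {0..<int N} \<Longrightarrow> [\<kappa> i = i + - 1] (mod int k)"
  using int_k_dvd_N by (auto simp: \<kappa>_def cong_iff_dvd_diff dvd_diff)

text \<open>The length of a face is a period of \<open>\<tau>\<close> or of \<open>\<kappa>\<close>.
  Modulo \<open>k\<close> these are translations by 2 and by -1, both coprime to the odd number
  \<open>k\<close>.\<close>

lemma face_card:
  assumes "F \<in> faces G rot"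
  shows "k dvd card F"
proof -
  obtain x p where F: "F = orbit (face_step rot) (arc x p)" and x: "x \<in> Zmod v"
    using assms unfolding faces_def by (metis imageE parcs_arcE)
  define n where "n = card F"
  have "(face_step rot ^^ n) (arc x p) = arc x p"
    unfolding n_def F by (intro funpow_fixed_card_orbit self_in_face arc_in_parcs x)
  then have period: "(\<phi> ^^ n) p mod (2 * int N) = p mod (2 * int N)"
    unfolding face_step_funpow_arc[OF x] arc_eq_iff by simp
  have "int k dvd int n"
  proof (cases p rule: residue_cases)
    case (1 i)
    then have "(\<tau> ^^ n) i = i" using period \<phi>_pow_even[of i p n] by simp
    moreover have "coprime 2 (int k)" using odd_k by simp
    ultimately show ?thesis
      using dvd_period[of "{0..<int N}" \<tau> 2 "int k" i n] \<tau>_cong \<tau>_range 1(1) by blast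
  next
    case (2 i)
    then have "(\<kappa> ^^ n) i = i" using period \<phi>_pow_odd[of i p n] by simp
    moreover have "coprime (- 1) (int k)" by simp
    ultimately show ?thesis
      using dvd_period[of "{0..<int N}" \<kappa> "- 1" "int k" i n] \<kappa>_cong \<kappa>_range 2(1) by blast
  qed
  then show ?thesis by (simp add: n_def)
qed


lemma \<tau>_pow_special:
  shows "j < k - 1 \<Longrightarrow> (\<tau> ^^ j) 2 = 2 + 2 * int j" and "(\<tau> ^^ (k - 1)) 2 = 5 * int k"
    and "(\<tau> ^^ k) 2 = 2"
proof -
  have run: "(\<tau> ^^ j) 2 = 2 + 2 * int j" if "j < k - 1" for j
    using that
  proof (induction j)
    case (Suc j)
    then have "(\<tau> ^^ Suc j) 2 = \<tau> (2 + 2 * int j)" by simp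
    also have "\<dots> = 2 + 2 * int (Suc j)"
    proof -
      have "int j + 3 \<le> int k" using Suc.prems by simp
      then show ?thesis using N_ge' by (subst \<tau>_eq) auto
    qed
    finally show ?case .
  qed simp
  then show "j < k - 1 \<Longrightarrow> (\<tau> ^^ j) 2 = 2 + 2 * int j" by blast
  have "k - 1 = Suc (k - 2)" "k = Suc (k - 1)" using k_ge by simp_all
  have "(\<tau> ^^ (k - 2)) 2 = 2 * int k - 2" using run[of "k - 2"] k_ge by simp
  then have "(\<tau> ^^ Suc (k - 2)) 2 = \<tau> (2 * int k - 2)" by simp
  also have "\<dots> = 5 * int k" using k_ge' N_ge' by (subst \<tau>_eq) auto
  finally show last: "(\<tau> ^^ (k - 1)) 2 = 5 * int k" using \<open>k - 1 = Suc (k - 2)\<close> by simp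
  have "(\<tau> ^^ Suc (k - 1)) 2 = \<tau> (5 * int k)" using last by simp
  also have "\<dots> = 2" using k_ge' N_ge' by (subst \<tau>_eq) auto
  finally show "(\<tau> ^^ k) 2 = 2" using \<open>k = Suc (k - 1)\<close> by simp
qed

text \<open>On the \<open>k\<close>-cycle the displacement over \<open>k\<close> steps is the sum in
  \<open>b_sum\<close>, hence zero; no other position recurs after \<open>k\<close> steps.\<close>

lemma face_period_iff:
  assumes x: "x \<in> Zmod v"
  shows "(face_step rot ^^ k) (arc x p) = arc x p \<longleftrightarrow> special_corner p"
proof
  assume "(face_step rot ^^ k) (arc x p) = arc x p"
  then have period: "(\<phi> ^^ k) p mod (2 * int N) = p mod (2 * int N)"
    unfolding face_step_funpow_arc[OF x] arc_eq_iff by simp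
  show "special_corner p"
  proof (cases p rule: residue_cases)
    case (1 i)
    then have "(\<tau> ^^ k) i = i" using period \<phi>_pow_even[of i p k] by simp
    then show ?thesis using 1 \<tau>_periodic_special by (simp add: special_corner_def)
  next
    case (2 i)
    then show ?thesis using period \<phi>_pow_odd[of i p k] \<kappa>_not_periodic[of i] by simp
  qed
next
  let ?f = "face_step rot"
  \<comment> \<open>Position 4 belongs to the point 2, the start of the \<open>k\<close>-cycle.
    Faces are first closed there and the conclusion is then carried along the cycle.\<close>
  have two: "2 \<in> {0..<int N}" "4 mod (2 * int N) = 2 * 2" using k_ge' N_ge' by auto
  have X_pow: "X ((\<phi> ^^ j) 4) = b ((\<tau> ^^ j) 2)" for j
    using \<phi>_pow_even[OF two, of j] X_eqs(1) by blast
  have "k = Suc (k - 1)" using k_ge by simp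
  then have "(\<Sum>j<k. X ((\<phi> ^^ j) 4)) = (\<Sum>j<Suc (k - 1). b ((\<tau> ^^ j) 2))"
    by (simp only: X_pow)
  also have "\<dots> = (\<Sum>j<k - 1. b (2 + 2 * int j)) + b (5 * int k)"
  proof -
    have "(\<Sum>j<k - 1. b ((\<tau> ^^ j) 2)) = (\<Sum>j<k - 1. b (2 + 2 * int j))"
      by (rule sum.cong) (simp_all add: \<tau>_pow_special(1))
    then show ?thesis by (simp only: sum.lessThan_Suc \<tau>_pow_special(2))
  qed
  finally have "(\<Sum>j<k. X ((\<phi> ^^ j) 4)) mod int v = 0" using b_sum by simp
  then have "(y + (\<Sum>j<k. X ((\<phi> ^^ j) 4))) mod int v = y" if "y \<in> Zmod v" for y
    using that by (metis Zmod_mod add.right_neutral mod_add_right_eq)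
  moreover have "(\<phi> ^^ k) 4 mod (2 * int N) = 4 mod (2 * int N)"
    using \<phi>_pow_even[OF two, of k] \<tau>_pow_special(3) two(2) by simp
  ultimately have base: "(?f ^^ k) (arc y 4) = arc y 4" if "y \<in> Zmod v" for y
    using that by (simp add: face_step_funpow_arc arc_eq_iff)
  assume "special_corner p"
  moreover define i where "i = p mod (2 * int N) div 2"
  ultimately have i: "special i" "p mod (2 * int N) = 2 * i"
    by (auto simp: special_corner_def)
  have "\<exists>j. (\<tau> ^^ j) 2 = i"
  proof (cases "i = 5 * int k")
    case False
    then have "nat ((i - 2) div 2) < k - 1" "2 + 2 * int (nat ((i - 2) div 2)) = i"
      using i(1) k_ge by (auto simp: special_def)
    then show ?thesis using \<tau>_pow_special(1) by metis
  qed (use \<tau>_pow_special(2) in blast)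
  then obtain j where j: "(\<tau> ^^ j) 2 = i" by blast
  \<comment> \<open>\<open>y\<close> is the vertex from which \<open>j\<close> face steps beginning
    at position 4 end at \<open>x\<close>.\<close>
  define y where "y = (x - (\<Sum>l<j. X ((\<phi> ^^ l) 4))) mod int v"
  have y: "y \<in> Zmod v" by (simp add: y_def)
  have "(y + (\<Sum>l<j. X ((\<phi> ^^ l) 4))) mod int v = x"
    unfolding y_def using x by (simp only: mod_add_left_eq) simp
  then have "(?f ^^ j) (arc y 4) = arc x p"
    using \<phi>_pow_even[OF two, of j] i(2) j by (simp add: face_step_funpow_arc[OF y] arc_eq_iff)
  moreover have "(?f ^^ k) ((?f ^^ j) (arc y 4)) = (?f ^^ j) ((?f ^^ k) (arc y 4))"
    by (rule funpow_left_comm)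
  ultimately show "(?f ^^ k) (arc x p) = arc x p" by (simp add: base[OF y])
qed

section \<open>Absence of dihedral symmetry\<close>

lemma special_corner_iff:
  assumes "0 \<le> r" "r < 2 * int N" "p mod (2 * int N) = r"
  shows "special_corner p \<longleftrightarrow> 4 dvd r \<and> 4 \<le> r \<and> r \<le> 4 * int k - 4 \<or> r = 10 * int k"
proof -
  have ev: "even p \<longleftrightarrow> even r" using assms(3) by auto
  show ?thesis
  proof (cases "even r")
    case True
    then obtain i where i: "r = 2 * i" by blast
    have "4 dvd 2 * i \<longleftrightarrow> even i" by presburger
    then show ?thesis using True unfolding special_corner_def special_def assms(3) ev i by auto
  next
    case False
    then have "\<not> 4 dvd r" by presburger
    moreover have "r \<noteq> 10 * int k" using False by auto
    ultimately show ?thesis using False by (simp add: special_corner_def ev)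
  qed
qed

text \<open>
  The corner \<open>10 k\<close> is the only special one without a special corner at distance four, so it is
  fixed by every dihedral symmetry of the set of special corners.
\<close>

lemma isolated_corner_iff:
  "special_corner p \<and> \<not> special_corner (p + 4) \<and> \<not> special_corner (p - 4) \<longleftrightarrow>
    p mod (2 * int N) = 10 * int k"
proof -
  define r where "r = p mod (2 * int N)"
  have r: "0 \<le> r" "r < 2 * int N" using k_ge' N_ge' by (simp_all add: r_def)
  note p = special_corner_iff[OF r r_def[symmetric]]
  have sc: "4 \<le> r \<and> r \<le> 10 * int k" if "special_corner p" using that p k_ge' by auto
  have plus: "special_corner (p + 4) \<longleftrightarrow> 4 dvd r + 4 \<and> 4 \<le> r + 4 \<and> r + 4 \<le> 4 * int k - 4 \<or> r + 4 = 10 * int k"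
    if "4 \<le> r \<and> r \<le> 10 * int k"
  proof (rule special_corner_iff)
    have "(p + 4) mod (2 * int N) = (r + 4) mod (2 * int N)" by (simp add: r_def mod_simps)
    also have "\<dots> = r + 4" using that k_ge' N_ge' by (intro mod_pos_pos_trivial) auto
    finally show "(p + 4) mod (2 * int N) = r + 4" .
  qed (use that k_ge' N_ge' in auto)
  have minus: "special_corner (p - 4) \<longleftrightarrow> 4 dvd r - 4 \<and> 4 \<le> r - 4 \<and> r - 4 \<le> 4 * int k - 4 \<or> r - 4 = 10 * int k"
    if "4 \<le> r \<and> r \<le> 10 * int k"
  proof (rule special_corner_iff)
    have "(p - 4) mod (2 * int N) = (r - 4) mod (2 * int N)" by (simp add: r_def mod_simps)
    also have "\<dots> = r - 4" using that k_ge' N_ge' by (intro mod_pos_pos_trivial) auto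
    finally show "(p - 4) mod (2 * int N) = r - 4" .
  qed (use that k_ge' N_ge' in auto)
  show ?thesis unfolding r_def[symmetric]
  proof
    assume A: "special_corner p \<and> \<not> special_corner (p + 4) \<and> \<not> special_corner (p - 4)"
    with sc have bounds: "4 \<le> r \<and> r \<le> 10 * int k" by blast
    show "r = 10 * int k"
    proof (rule ccontr)
      assume "r \<noteq> 10 * int k"
      with A p have r4: "4 dvd r" "r \<le> 4 * int k - 4" by auto
      then obtain l where l: "r = 4 * l" by blast
      have "4 dvd r + 4" "4 dvd r - 4" using r4 by simp_all
      then have "r + 4 > 4 * int k - 4" "r - 4 < 4"
        using A plus[OF bounds] minus[OF bounds] r4(2) bounds by auto
      then have "int k - 1 \<le> l" "l < 2" using l by simp_all
      then show False using k_ge' by linarith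
    qed
  next
    assume "r = 10 * int k"
    with p plus minus k_ge' show
      "special_corner p \<and> \<not> special_corner (p + 4) \<and> \<not> special_corner (p - 4)" by auto
  qed
qed

lemma no_rotation:
  assumes "\<And>p. special_corner p \<longleftrightarrow> special_corner (p + l)"
  shows "l mod int (2 * N) = 0"
proof -
  have "10 * int k mod (2 * int N) = 10 * int k" using k_ge' N_ge' by auto
  then have "(10 * int k + l) mod (2 * int N) = 10 * int k"
    using isolated_corner_iff[of "10 * int k"] isolated_corner_iff[of "10 * int k + l"]
      assms[of "10 * int k"] assms[of "10 * int k + 4"] assms[of "10 * int k - 4"]
    by (simp add: algebra_simps)
  then have "(10 * int k + l) mod (2 * int N) = (10 * int k + 0) mod (2 * int N)"
    using k_ge' N_ge' by simp
  then have "[10 * int k + l = 10 * int k + 0] (mod (2 * int N))" by (simp only: cong_def)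
  then show ?thesis by (simp only: cong_add_lcancel) (simp add: cong_def)
qed

text \<open>A reflection fixes the isolated corner \<open>10 k\<close>, so \<open>c\<close> is
  congruent to \<open>20 k\<close>. It would send the special corner 4 to \<open>20 k - 4\<close>,
  which is not special.\<close>

lemma no_reflection: "\<not> (\<forall>p. special_corner p \<longleftrightarrow> special_corner (c - p))"
proof
  assume sym: "\<forall>p. special_corner p \<longleftrightarrow> special_corner (c - p)"
  have mod10: "10 * int k mod (2 * int N) = 10 * int k" using k_ge' N_ge' by auto
  have a: "special_corner (10 * int k + d) \<longleftrightarrow> special_corner (c - 10 * int k - d)" for d
    using spec[OF sym, of "10 * int k + d"] by (simp add: algebra_simps)
  have "(c - 10 * int k) mod (2 * int N) = 10 * int k"
    using isolated_corner_iff[of "10 * int k"] isolated_corner_iff[of "c - 10 * int k"] mod10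
      a[of 0] a[of 4] a[of "- 4"] by (simp add: algebra_simps)
  then have "(c - 10 * int k + (10 * int k - 4)) mod (2 * int N) =
    (10 * int k + (10 * int k - 4)) mod (2 * int N)" by (metis mod_add_left_eq)
  also have "\<dots> = 20 * int k - 4" using k_ge' N_ge' by simp
  finally have c: "(c - 4) mod (2 * int N) = 20 * int k - 4" by simp
  have "special_corner 4"
    using special_corner_iff[of 4 4] k_ge' N_ge' by simp
  then have "special_corner (c - 4)" using sym by blast
  then show False
    using special_corner_iff[OF _ _ c] k_ge' N_ge' by simp
qed

lemma Aut_rot: "Aut G rot = translation v ` Zmod v"
  by (rule Aut_eq_translations[OF face_period_iff no_rotation no_reflection])

end

section \<open>Counting\<close>

text \<open>A rotation determines its enumeration only up to a shift of positions; the common value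
  at 2 fixes the shift, and iterating the rotation from there recovers all values.\<close>

lemma filling_eq:
  assumes f: "filling v N k G b" "filling v N k G b'"
    and rot: "cayley_rotation.rot v G (filling.X v N k b) = cayley_rotation.rot v G (filling.X v N k b')"
    and base: "b 2 = b' 2" and i: "i \<in> {0..<int N}"
  shows "b i = b' i"
proof -
  interpret A: filling v N k G b by (rule f)
  interpret B: filling v N k G b' by (rule f)
  have zero: "0 \<in> Zmod v" using A.v_pos by (simp add: Zmod_def)
  have two: "2 \<in> {0..<int N}" using A.N_ge' A.k_ge' by simp
  have "A.arc 0 (4 + int n) = B.arc 0 (4 + int n)" for n
  proof (induction n)
    case 0
    show ?case using A.X_even[OF two] B.X_even[OF two] base by (simp add: A.arc_def B.arc_def)
  next
    case (Suc n)
    have "A.rot (A.arc 0 (4 + int n)) = B.rot (B.arc 0 (4 + int n))" using Suc rot by simp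
    then show ?case unfolding A.rot_arc[OF zero] B.rot_arc[OF zero] by (simp add: algebra_simps)
  qed
  then have "A.X (4 + int n) = B.X (4 + int n)" for n
    using A.arc_diff B.arc_diff by metis
  \<comment> \<open>Adding the period \<open>2 * N\<close> keeps the number of iterations
    nonnegative.\<close>
  from this[of "nat (2 * i + 2 * int N - 4)"] have "A.X (2 * i + 2 * int N) = B.X (2 * i + 2 * int N)"
    using i two A.N_ge' A.k_ge' by (simp add: algebra_simps)
  moreover have "A.X (2 * i + 2 * int N) = A.X (2 * i)" "B.X (2 * i + 2 * int N) = B.X (2 * i)"
    using A.X_mod[of "2 * i + 2 * int N"] A.X_mod[of "2 * i"]
      B.X_mod[of "2 * i + 2 * int N"] B.X_mod[of "2 * i"] by simp_all
  ultimately show ?thesis using A.X_even[OF i] B.X_even[OF i] by simp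
qed

section \<open>Differences in the complete multipartite graph\<close>

lemma complete_multipartite_simps:
  assumes "0 < m" "0 < t"
  shows "pverts (complete_multipartite m t) = Zmod (m * t)"
    and "parcs (complete_multipartite m t) =
      {(x, y). x \<in> Zmod (m * t) \<and> y \<in> Zmod (m * t) \<and> \<not> int m dvd y - x}"
proof -
  let ?v = "int (m * t)"
  have "(x - y) mod ?v \<in> (\<lambda>j. (int m * j) mod ?v) ` Zmod (m * t) \<longleftrightarrow> int m dvd y - x" for x y
  proof
    assume "(x - y) mod ?v \<in> (\<lambda>j. (int m * j) mod ?v) ` Zmod (m * t)"
    then obtain j where "(x - y) mod ?v = (int m * j) mod ?v" by blast
    then have "(x - y) mod ?v mod int m = (int m * j) mod ?v mod int m" by simp
    then have "(x - y) mod int m = 0" by (simp add: mod_mod_cancel)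
    then have "int m dvd x - y" by (simp add: dvd_eq_mod_eq_0)
    then show "int m dvd y - x" by (subst dvd_diff_commute)
  next
    assume "int m dvd y - x"
    then obtain q where q: "x - y = int m * q" by (metis dvdE dvd_diff_commute)
    have "(x - y) mod ?v = (int m * (q mod ?v)) mod ?v" by (simp add: q mod_simps)
    moreover have "q mod ?v \<in> Zmod (m * t)" using assms by (simp add: Zmod_def)
    ultimately show "(x - y) mod ?v \<in> (\<lambda>j. (int m * j) mod ?v) ` Zmod (m * t)" by blast
  qed
  then show "parcs (complete_multipartite m t) =
      {(x, y). x \<in> Zmod (m * t) \<and> y \<in> Zmod (m * t) \<and> \<not> int m dvd y - x}"
    by (simp add: complete_multipartite_def Let_def)
qed (simp add: complete_multipartite_def Let_def)

definition half_system :: "nat \<Rightarrow> nat \<Rightarrow> int set" where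
  "half_system v m = {a. 0 < a \<and> 2 * a < int v \<and> \<not> int m dvd a}"

text \<open>No difference outside the subgroup is its own negative: for odd \<open>t\<close> the
  number \<open>v\<close> is odd, and for even \<open>t\<close> its half is a multiple of
  \<open>m\<close>. So the residues split into the \<open>t\<close> multiples of \<open>m\<close>,
  the half-system and its negatives.\<close>

lemma card_half_system:
  assumes v: "v = m * t" "v = 2 * N + t" and pos: "0 < m" "0 < t"
  shows "card (half_system v m) = N"
    and "\<not> int m dvd a \<Longrightarrow> 2 * a \<noteq> int v"
proof -
  have no_mid: "2 * a \<noteq> int v" if "\<not> int m dvd a" for a
  proof
    assume a: "2 * a = int v"
    show False
    proof (cases "even t")
      case True
      then obtain s where "t = 2 * s" by blast
      then have "a = int m * int s" using a v(1) by simp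
      with that show False by simp
    next
      case False
      then have "odd v" using v(2) by simp
      then show False using a by presburger
    qed
  qed
  then show "\<not> int m dvd a \<Longrightarrow> 2 * a \<noteq> int v" .
  let ?T = "half_system v m"
  let ?U = "(\<lambda>a. int v - a) ` ?T"
  let ?J = "(\<lambda>j. int m * j) ` {0..<int t}"
  have fin: "finite ?T" by (rule finite_subset[of _ "{0..<int v}"]) (auto simp: half_system_def)
  have mv: "int m dvd int v" using v(1) by simp
  have "{0..<int v} = ?J \<union> (?T \<union> ?U)"
  proof (intro equalityI subsetI)
    fix a assume a: "a \<in> {0..<int v}"
    show "a \<in> ?J \<union> (?T \<union> ?U)"
    proof (cases "int m dvd a")
      case True
      then obtain j where j: "a = int m * j" by blast
      have "0 \<le> int m * j" "int m * j < int m * int t" using a v(1) by (auto simp: j)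
      then have "j \<in> {0..<int t}" using pos by (simp add: zero_le_mult_iff)
      then show ?thesis using j by blast
    next
      case False
      then have "a \<noteq> 0" by auto
      have "2 * a < int v \<or> 2 * (int v - a) < int v" using no_mid[OF False] by arith
      then consider "2 * a < int v" | "2 * (int v - a) < int v" by blast
      then show ?thesis
      proof cases
        case 1
        then show ?thesis using a \<open>a \<noteq> 0\<close> False by (simp add: half_system_def)
      next
        case 2
        have "\<not> int m dvd int v - a" using False mv by (simp add: dvd_diff_right_iff)
        then have "int v - a \<in> ?T" using a 2 by (simp add: half_system_def)
        then have "int v - (int v - a) \<in> ?U" by blast
        then show ?thesis by simp
      qed
    qed
  next
    fix a assume "a \<in> ?J \<union> (?T \<union> ?U)"
    then consider "a \<in> ?J" | "a \<in> ?T" | "int v - a \<in> ?T" by auto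
    then show "a \<in> {0..<int v}"
    proof cases
      case 1
      then obtain j where "a = int m * j" "j \<in> {0..<int t}" by blast
      then have j: "a = int m * j" "0 \<le> j" "j < int t" by simp_all
      then have "int m * j < int m * int t" using pos by simp
      then show ?thesis using j v(1) by simp
    qed (auto simp: half_system_def)
  qed
  moreover have "?T \<inter> ?U = {}" by (auto simp: half_system_def)
  moreover have "?J \<inter> (?T \<union> ?U) = {}"
  proof -
    have "\<not> int m dvd a" if "a \<in> ?T \<union> ?U" for a
      using that mv by (auto simp: half_system_def dvd_diff_right_iff)
    moreover have "int m dvd a" if "a \<in> ?J" for a using that by auto
    ultimately show ?thesis by blast
  qed
  moreover have "card ?J = t" using pos by (subst card_image) (auto simp: inj_on_def)
  moreover have "card ?U = card ?T" by (rule card_image) (simp add: inj_on_def)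
  ultimately have "card {0..<int v} = t + (card ?T + card ?T)"
    using fin by (simp add: card_Un_disjoint)
  then show "card ?T = N" using v(2) by simp
qed

text \<open>Replacing \<open>u i\<close> by its negative leaves the represented pair unchanged, so
  enumeration and signs are free apart from the zero-sum condition.\<close>

lemma filling_of_half_system:
  assumes v: "v = m * t" "v = 2 * N + t" and t: "0 < t" and k: "3 \<le> k" "odd k" "k dvd N" "odd N" "16 * k \<le> N"
    and m: "2 * k < m"
    and u: "bij_betw u {0..<int N} (half_system v m)"
    and b: "b = (\<lambda>i. if s i then u i else int v - u i)"
    and sum: "((\<Sum>j<k - 1. b (2 + 2 * int j)) + b (5 * int k)) mod int v = 0"
  shows "filling v N k (complete_multipartite m t) b"
proof
  let ?G = "complete_multipartite m t"
  have mpos: "0 < m" using m by simp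
  have G: "pverts ?G = Zmod v" "parcs ?G = {(x, y). x \<in> Zmod v \<and> y \<in> Zmod v \<and> \<not> int m dvd y - x}"
    using complete_multipartite_simps[OF mpos t] v(1) by simp_all
  have mv: "int m dvd int v" using v(1) by simp
  have u_range: "0 < u i" "2 * u i < int v" "\<not> int m dvd u i" if "i \<in> {0..<int N}" for i
    using bij_betwE[OF u] that by (auto simp: half_system_def)
  have u_eq: "u i = u j \<longleftrightarrow> i = j" if "i \<in> {0..<int N}" "j \<in> {0..<int N}" for i j
    using u that by (auto simp: bij_betw_def inj_on_eq_iff)
  have v_pos: "0 < v" using v(2) t by simp
  show "0 < v" "pverts ?G = Zmod v" by (fact v_pos, fact G(1))
  show range: "0 < b i \<and> b i < int v" if "i \<in> {0..<int N}" for i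
    using u_range[OF that] by (auto simp: b)
  show "inj_on b {0..<int N}"
  proof (rule inj_onI)
    fix i j assume ij: "i \<in> {0..<int N}" "j \<in> {0..<int N}" "b i = b j"
    then have "u i = u j" using u_range[OF ij(1)] u_range[OF ij(2)] by (auto simp: b split: if_splits)
    then show "i = j" using u_eq ij by blast
  qed
  show "b i + b j \<noteq> int v" if "i \<in> {0..<int N}" "j \<in> {0..<int N}" for i j
  proof
    assume *: "b i + b j = int v"
    then have "u i = u j" using u_range[OF that(1)] u_range[OF that(2)] by (auto simp: b split: if_splits)
    then have "i = j" using u_eq that by blast
    then show False using * u_range[OF that(1)] by (auto simp: b split: if_splits)
  qed
  have mem: "\<not> int m dvd d \<longleftrightarrow> (\<exists>i\<in>{0..<int N}. d = b i \<or> d = (- b i) mod int v)"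
    if d: "d \<in> {0..<int v}" for d
  proof -
    have neg: "(- b i) mod int v = int v - b i" if "i \<in> {0..<int N}" for i
      using range[OF that] by (simp add: zmod_zminus1_eq_if)
    have "(\<exists>i\<in>{0..<int N}. d = b i \<or> d = (- b i) mod int v) \<longleftrightarrow>
        (\<exists>i\<in>{0..<int N}. d = u i \<or> int v - d = u i)"
    proof (rule bex_cong[OF refl])
      fix i assume i: "i \<in> {0..<int N}"
      show "d = b i \<or> d = (- b i) mod int v \<longleftrightarrow> d = u i \<or> int v - d = u i"
        unfolding neg[OF i] unfolding b by auto
    qed
    also have "\<dots> \<longleftrightarrow> d \<in> u ` {0..<int N} \<or> int v - d \<in> u ` {0..<int N}" by blast
    also have "u ` {0..<int N} = half_system v m" using u by (simp add: bij_betw_def)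
    also have "d \<in> half_system v m \<or> int v - d \<in> half_system v m \<longleftrightarrow> \<not> int m dvd d"
    proof
      assume nd: "\<not> int m dvd d"
      then have "d \<noteq> 0" by auto
      moreover have "2 * d \<noteq> int v" using card_half_system(2)[OF v mpos t nd] .
      moreover have "\<not> int m dvd int v - d" using nd mv by (simp add: dvd_diff_right_iff)
      ultimately show "d \<in> half_system v m \<or> int v - d \<in> half_system v m"
        using d nd by (auto simp: half_system_def)
    qed (use mv in \<open>auto simp: half_system_def dvd_diff_right_iff\<close>)
    finally show ?thesis by blast
  qed
  have "int m dvd y - x \<longleftrightarrow> int m dvd (y - x) mod int v" for x y :: int
    using mv by (simp add: dvd_mod_iff)
  moreover have "(y - x) mod int v \<in> {0..<int v}" for x y :: int using v_pos by simp
  ultimately show "parcs ?G = {(x, y). x \<in> Zmod v \<and> y \<in> Zmod v \<and>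
      (\<exists>i\<in>{0..<int N}. (y - x) mod int v = b i \<or> (y - x) mod int v = (- b i) mod int v)}"
    unfolding G using mem by simp
  show "\<exists>s\<in>Zmod v. \<exists>s'\<in>Zmod v. (0, s) \<in> parcs ?G \<and> (0, s') \<in> parcs ?G \<and> y = (s + s') mod int v"
    if y: "y \<in> Zmod v" for y
  proof -
    have v2: "2 < int v" using k v(2) by simp
    \<comment> \<open>Since \<open>m > 2\<close>, at most one of \<open>y - 1\<close> and
      \<open>y - 2\<close> is a multiple of \<open>m\<close>, and neither 1 nor 2 is.\<close>
    obtain s where s: "s = 1 \<or> s = 2" "\<not> int m dvd y - s"
    proof (cases "int m dvd y - 1")
      case True
      have "\<not> int m dvd y - 2"
      proof
        assume "int m dvd y - 2"
        then have "int m dvd (y - 1) - (y - 2)" using True by (rule dvd_diff[rotated])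
        then show False using m k by simp
      qed
      then show ?thesis using that[of 2] by simp
    qed (use that[of 1] in simp)
    have "\<not> int m dvd s" using s(1) m k by (auto dest: zdvd_imp_le)
    moreover have "\<not> int m dvd (y - s) mod int v" using s(2) mv by (simp add: dvd_mod_iff)
    moreover have "y = (s + (y - s) mod int v) mod int v" using y by (simp add: mod_simps Zmod_def)
    moreover have "s \<in> Zmod v" "0 \<in> Zmod v" "(y - s) mod int v \<in> Zmod v" using s(1) v2 by (auto simp: Zmod_def)
    ultimately show ?thesis unfolding G by auto
  qed
qed (use k sum in auto)

text \<open>Values with sum zero on the cycle of length \<open>k\<close>: an alternating run and its defect.\<close>

definition special_value :: "nat \<Rightarrow> int \<Rightarrow> int" where
  "special_value k i = (if i = 5 * int k then (int k - 1) div 2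
     else (if 4 dvd i - 2 then 1 else - 1) * (int k + (i - 2) div 2))"

text \<open>For \<open>k = 2 * h + 1\<close> each of the \<open>h\<close> consecutive pairs of the
  run contributes -1, and the value at \<open>5 * k\<close> is \<open>h\<close>.\<close>

lemma sum_special_value:
  assumes "odd k" "3 \<le> k"
  shows "(\<Sum>j<k - 1. special_value k (2 + 2 * int j)) + special_value k (5 * int k) = 0"
proof -
  have val: "special_value k (2 + 2 * int j) = (if even j then 1 else - 1) * (int k + int j)"
    if "j < k - 1" for j
  proof -
    have "2 + 2 * int j \<noteq> 5 * int k" using that by linarith
    moreover have "4 dvd 2 * int j \<longleftrightarrow> even j" by presburger
    ultimately show ?thesis by (simp add: special_value_def)
  qed
  obtain h where h: "k = 2 * h + 1" using assms(1) by (metis oddE)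
  have "(\<Sum>j<2 * h'. (if even j then 1 else - 1) * (int k + int j)) = - int h'" for h'
    by (induction h') simp_all
  moreover have "(\<Sum>j<k - 1. special_value k (2 + 2 * int j)) =
      (\<Sum>j<k - 1. (if even j then 1 else - 1) * (int k + int j))"
    by (rule sum.cong) (simp_all add: val)
  ultimately show ?thesis by (simp add: special_value_def h)
qed


text \<open>The run has absolute values from \<open>k\<close> to \<open>2 * k - 2\<close>, all above
  the last value \<open>(k - 1) / 2\<close>; so the special values come from distinct pairs.\<close>

lemma special_value_abs:
  assumes "odd k" "3 \<le> k" "even i" "2 \<le> i" "i \<le> 2 * int k - 2"
  shows "\<bar>special_value k i\<bar> = int k + (i - 2) div 2"
  using assms by (auto simp: special_value_def)

section \<open>The number of embeddings\<close>

lemma fact_le_pow_two_fact: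
  fixes n k N :: nat
  assumes N: "N = n * k" and "k \<le> n" "7 \<le> n"
  shows "fact N \<le> 2 ^ (N - k) * (fact (N - k) :: nat)"
proof -
  have kN: "k \<le> N" using assms by simp
  \<comment> \<open>Raised to the power \<open>k\<close>, this yields
    \<open>N ^ k \<le> 2 ^ (N - k)\<close>, and the quotient of the factorials is at most
    \<open>N ^ k\<close>. The inequality fails at \<open>n = 6\<close>, whence the bound 7.\<close>
  have "2 * n ^ 2 \<le> (2::nat) ^ n"
    using \<open>7 \<le> n\<close>
  proof (induction n rule: dec_induct)
    case (step n)
    have "2 * (Suc n)\<^sup>2 \<le> 2 * (2 * n\<^sup>2)"
    proof -
      have "2 * n + 1 \<le> 7 * n" using step by simp
      also have "\<dots> \<le> n * n" using step by simp
      finally show ?thesis by (simp add: power2_eq_square)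
    qed
    with step show ?case by simp
  qed simp
  moreover have "2 * N \<le> 2 * n ^ 2" using assms by (simp add: power2_eq_square)
  ultimately have "(2 * N) ^ k \<le> (2 ^ n) ^ k" by (intro power_mono) simp_all
  then have "2 ^ k * N ^ k \<le> 2 ^ N" by (simp add: N power_mult power_mult_distrib)
  also have "(2::nat) ^ N = 2 ^ k * 2 ^ (N - k)" using kN by (simp flip: power_add)
  finally have "N ^ k \<le> 2 ^ (N - k)" by simp
  moreover have "fact N div fact (N - k) \<le> N ^ k" by (rule fact_div_fact_le_pow[OF kN])
  moreover have "fact N = fact N div fact (N - k) * (fact (N - k) :: nat)"
    by (simp add: fact_dvd)
  ultimately show ?thesis by (metis le_trans mult_le_mono1)
qed

text \<open>With the values on the \<open>k\<close>-cycle prescribed, each permutation of the other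
  indices together with a set of positive signs gives its own rotation.\<close>

lemma card_biembeddings_ge:
  fixes t n k :: nat
  defines "N \<equiv> n * k" and "v \<equiv> 2 * n * k + t" and "m \<equiv> (2 * n * k + t) div t"
  assumes t: "0 < t" "t dvd 2 * n * k" and odd: "odd n" "odd k" and k: "3 \<le> k" "k < n"
    and n: "16 \<le> n" "t \<le> n"
  defines "G \<equiv> complete_multipartite m t"
  shows "fact N \<le> card {\<rho>. biembedding G \<rho> \<and> Aut G \<rho> = translation v ` Zmod v \<and>
    (\<forall>F\<in>faces G \<rho>. k dvd card F)}"
proof -
  let ?good = "{\<rho>. biembedding G \<rho> \<and> Aut G \<rho> = translation v ` Zmod v \<and>
    (\<forall>F\<in>faces G \<rho>. k dvd card F)}"
  let ?I = "{0..<int N}"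
  have v: "v = m * t" "v = 2 * N + t" using t by (simp_all add: v_def m_def N_def)
  \<comment> \<open>Here \<open>t \<le> n\<close> bounds \<open>m\<close> from below by
    \<open>2 * k + 1\<close>, which keeps the prescribed values outside the subgroup.\<close>
  have "2 * k * t + t \<le> v" using n v(2) by (simp add: N_def)
  then have "(2 * k + 1) * t \<le> m * t" using v(1) by simp
  then have "2 * k + 1 \<le> m" unfolding mult_le_cancel2 using t by blast
  then have m: "2 * k < m" by simp
  have N: "odd N" "k dvd N" "16 * k \<le> N" using odd n by (simp_all add: N_def)
  let ?P = "{i. even i \<and> 2 \<le> i \<and> i \<le> 2 * int k - 2} \<union> {5 * int k}"
  define P where "P = ?P"
  have P_sub: "P \<subseteq> ?I" using N(3) k by (auto simp: P_def)
  have P_eq: "P = insert (5 * int k) ((\<lambda>j. 2 + 2 * int j) ` {..<k - 1})"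
  proof -
    have run: "i \<in> (\<lambda>j. 2 + 2 * int j) ` {..<k - 1}" if "even i" "2 \<le> i" "i \<le> 2 * int k - 2" for i
      using that k by (intro image_eqI[of _ _ "nat ((i - 2) div 2)"]) auto
    have "{i. even i \<and> 2 \<le> i \<and> i \<le> 2 * int k - 2} = (\<lambda>j. 2 + 2 * int j) ` {..<k - 1}"
    proof (intro equalityI subsetI)
      fix i assume "i \<in> (\<lambda>j. 2 + 2 * int j) ` {..<k - 1}"
      then show "i \<in> {i. even i \<and> 2 \<le> i \<and> i \<le> 2 * int k - 2}" by auto
    qed (use run in blast)
    then show ?thesis by (simp add: P_def)
  qed
  have card_P: "card P = k"
  proof -
    have "5 * int k \<notin> (\<lambda>j. 2 + 2 * int j) ` {..<k - 1}" by auto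
    moreover have "card ((\<lambda>j. 2 + 2 * int j) ` {..<k - 1}) = k - 1"
      by (subst card_image) (auto simp: inj_on_def)
    ultimately show ?thesis using k by (simp add: P_eq)
  qed
  define T where "T = half_system v m"
  define a where "a = (\<lambda>i. \<bar>special_value k i\<bar>)"
  have a_last: "a (5 * int k) = (int k - 1) div 2" using k by (simp add: a_def special_value_def)
  have a_run: "a i = int k + (i - 2) div 2" if "even i" "2 \<le> i" "i \<le> 2 * int k - 2" for i
    using special_value_abs[OF odd(2) k(1) that] by (simp add: a_def)
  have a_inj: "inj_on a P"
  proof (rule inj_onI)
    fix i j assume "i \<in> P" "j \<in> P" "a i = a j"
    then show "i = j" using a_last a_run[of i] a_run[of j] k by (auto simp: P_def)
  qed
  have small: "c \<in> T" if "0 < c" "c < 2 * int k" for c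
  proof -
    have "\<not> int m dvd c" using that m by (auto dest: zdvd_imp_le)
    then show ?thesis using that N(3) v(2) by (simp add: T_def half_system_def)
  qed
  have a_T: "a ` P \<subseteq> T"
  proof (rule image_subsetI)
    fix i assume "i \<in> P"
    then have "0 < a i \<and> a i < 2 * int k"
      using a_last a_run[of i] k by (auto simp: P_def)
    then show "a i \<in> T" using small by simp
  qed
  have fin_T: "finite T" by (rule finite_subset[of _ "{0..<int v}"]) (auto simp: T_def half_system_def)
  have "card T = N" unfolding T_def by (rule card_half_system(1)[OF v]) (use m t in simp_all)
  define A where "A = ?I - P"
  have fin_A: "finite A" by (simp add: A_def)
  have card_A: "card A = N - k"
    using P_sub card_P unfolding A_def by (subst card_Diff_subset) (auto intro: finite_subset)
  have "card (T - a ` P) = N - k"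
    using a_T fin_T \<open>card T = N\<close> card_P card_image[OF a_inj]
    by (subst card_Diff_subset) (auto intro: finite_subset)
  then obtain e where e: "bij_betw e A (T - a ` P)"
    using finite_same_card_bij[OF fin_A, of "T - a ` P"] fin_T card_A by auto
  \<comment> \<open>\<open>e\<close> is a fixed reference bijection onto the part of the half-system
    left over by \<open>P\<close>; the parameter \<open>p\<close> rearranges it.\<close>
  define u where "u = (\<lambda>p i. if i \<in> P then a i else e (p i))"
  define s where "s = (\<lambda>E i. if i \<in> P then 0 < special_value k i else i \<in> E)"
  define b where "b = (\<lambda>(p, E) i. if s E i then u p i else int v - u p i)"
  define param where "param = {p. p permutes A} \<times> Pow A"
  have u_bij: "bij_betw (u p) ?I T" if p: "p permutes A" for p
  proof -
    have "bij_betw (u p) P (a ` P)"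
      using a_inj by (subst bij_betw_cong[of _ _ a]) (simp_all add: u_def inj_on_imp_bij_betw)
    moreover have "bij_betw (e \<circ> p) A (T - a ` P)"
      using permutes_imp_bij[OF p] e by (rule bij_betw_trans)
    then have "bij_betw (u p) A (T - a ` P)"
      by (subst bij_betw_cong[of _ _ "e \<circ> p"]) (simp_all add: u_def A_def)
    ultimately have "bij_betw (u p) (P \<union> A) (a ` P \<union> (T - a ` P))"
      by (rule bij_betw_combine) auto
    moreover have "P \<union> A = ?I" "a ` P \<union> (T - a ` P) = T" using P_sub a_T by (auto simp: A_def)
    ultimately show ?thesis by simp
  qed
  have b_P: "[b (p, E) i = special_value k i] (mod int v)" if "i \<in> P" for p E i
    using that by (auto simp: b_def s_def u_def a_def cong_iff_dvd_diff abs_if)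
  have fill: "filling v N k G (b x)" if x: "x \<in> param" for x
  proof -
    obtain p E where pE: "x = (p, E)" "p permutes A" using x by (auto simp: param_def)
    have "[(\<Sum>j<k - 1. b x (2 + 2 * int j)) + b x (5 * int k) =
        (\<Sum>j<k - 1. special_value k (2 + 2 * int j)) + special_value k (5 * int k)] (mod int v)"
      unfolding pE(1) by (intro cong_add cong_sum b_P) (auto simp: P_eq)
    then have "((\<Sum>j<k - 1. b x (2 + 2 * int j)) + b x (5 * int k)) mod int v = 0"
      unfolding sum_special_value[OF odd(2) k(1)] by (simp add: cong_def)
    then show ?thesis unfolding G_def
      by (intro filling_of_half_system[OF v t(1) k(1) odd(2) N(2,1,3) m, of "u p" _ "s E"])
        (use u_bij[OF pE(2)] in \<open>simp_all add: T_def b_def pE(1)\<close>)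
  qed
  define R where "R = (\<lambda>x. cayley_rotation.rot v G (filling.X v N k (b x)))"
  have "inj_on R param"
  proof (rule inj_onI)
    fix x y assume xy: "x \<in> param" "y \<in> param" "R x = R y"
    obtain p E q F where x: "x = (p, E)" "p permutes A" "E \<subseteq> A" and y: "y = (q, F)" "q permutes A" "F \<subseteq> A"
      using xy by (auto simp: param_def)
    \<comment> \<open>The point 2 lies on the \<open>k\<close>-cycle, where values do not depend on
      the parameters; this is the common value that \<open>filling_eq\<close> asks for.\<close>
    have "2 \<in> P" using k by (simp add: P_def)
    then have "b x 2 = b y 2" by (simp add: x y b_def s_def u_def)
    then have b_eq: "b x i = b y i" if "i \<in> ?I" for i
      using filling_eq[OF fill[OF xy(1)] fill[OF xy(2)] _ _ that] xy(3) by (simp add: R_def)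
    have A_eq: "p i = q i \<and> (i \<in> E \<longleftrightarrow> i \<in> F)" if i: "i \<in> A" for i
    proof -
      have i': "i \<in> ?I" "i \<notin> P" using i by (auto simp: A_def)
      have pq: "p i \<in> A" "q i \<in> A" using permutes_in_image[OF x(2)] permutes_in_image[OF y(2)] i by auto
      have "e (p i) \<in> T" "e (q i) \<in> T" using bij_betwE[OF e] pq by auto
      \<comment> \<open>Elements of the half-system lie below \<open>v / 2\<close> and their
        negatives above, so a value reveals both its sign and its pair.\<close>
      then have "2 * e (p i) < int v" "2 * e (q i) < int v" by (auto simp: T_def half_system_def)
      then have "e (p i) = e (q i) \<and> (i \<in> E \<longleftrightarrow> i \<in> F)"
        using b_eq[OF i'(1)] i'(2) by (auto simp: x(1) y(1) b_def s_def u_def split: if_splits)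
      then show ?thesis using e pq by (auto simp: bij_betw_def inj_on_eq_iff)
    qed
    then have "E = F" using x(3) y(3) by blast
    moreover have "p = q"
      using A_eq permutes_not_in[OF x(2)] permutes_not_in[OF y(2)] by (metis ext)
    ultimately show "x = y" by (simp add: x y)
  qed
  moreover have "R ` param \<subseteq> ?good"
  proof (rule image_subsetI)
    fix x assume "x \<in> param"
    then interpret filling v N k G "b x" by (rule fill)
    show "R x \<in> ?good"
      unfolding R_def using biembedding_rot Aut_rot face_card by simp
  qed
  moreover have "finite ?good"
  proof (cases "param = {}")
    case False
    then obtain x where "x \<in> param" by blast
    then interpret filling v N k G "b x" by (rule fill)
    show ?thesis
      by (rule finite_subset[OF _ finite_embeddings]) (auto simp: biembedding_def)
  qed (auto simp: param_def intro: permutes_id)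
  ultimately have "card param \<le> card ?good" by (rule card_inj_on_le)
  moreover have "card param = fact (N - k) * 2 ^ (N - k)"
    by (simp add: param_def card_cartesian_product card_permutations[OF card_A fin_A] card_Pow[OF fin_A] card_A)
  ultimately show ?thesis
    using fact_le_pow_two_fact[OF N_def[THEN meta_eq_to_obj_eq]] k n by (simp add: mult.commute)
qed

theorem corollary4p10:
  fixes t :: nat
  assumes "t > 0" and "\<not> [t = 0] (mod 4)"
  shows "\<exists>C::real. \<forall>n k :: nat.
    n > 0 \<longrightarrow> k > 0 \<longrightarrow> k < n \<longrightarrow> t dvd 2 * n * k \<longrightarrow>
    (odd (n * k) \<and> n \<ge> k \<and> k \<ge> 3 \<and> gcd n (k - 1) = 1) \<or>
    (odd (n * k) \<and> n \<ge> k \<and> 3 < k \<and> k < 200) \<or>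
    (odd (n * k) \<and> n \<ge> k \<and> k \<ge> 3 \<and> n \<ge> (k - 2) * (k - 1)) \<longrightarrow>
    (let v = 2 * n * k + t; G = complete_multipartite (v div t) t in
     real (card {\<rho>. biembedding G \<rho> \<and>
                    Aut G \<rho> = translation v ` Zmod v \<and>
                    (\<forall>F\<in>faces G \<rho>. k dvd card F)})
       \<ge> (1 - C / real (n * k)) * fact (n * k))"
proof -
  \<comment> \<open>For \<open>n < 16 + t\<close> the product \<open>n * k\<close> is at most
    \<open>C\<close>, so the claimed bound is nonpositive; for larger \<open>n\<close> both
    \<open>16 \<le> n\<close> and \<open>t \<le> n\<close> hold and the counting lemma
    applies.\<close>
  define C where "C = real ((16 + t)\<^sup>2)"
  have main: "real (card {\<rho>. biembedding (complete_multipartite ((2 * n * k + t) div t) t) \<rho> \<and>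
        Aut (complete_multipartite ((2 * n * k + t) div t) t) \<rho> =
          translation (2 * n * k + t) ` Zmod (2 * n * k + t) \<and>
        (\<forall>F\<in>faces (complete_multipartite ((2 * n * k + t) div t) t) \<rho>. k dvd card F)})
      \<ge> (1 - C / real (n * k)) * fact (n * k)"
    if nk: "t dvd 2 * n * k" "odd (n * k)" "3 \<le> k" "k < n" for n k
  proof (cases "16 + t \<le> n")
    case True
    have "(1 - C / real (n * k)) * fact (n * k) \<le> 1 * fact (n * k)"
      by (intro mult_right_mono) (simp_all add: C_def)
    also have "\<dots> = real (fact (n * k))" by simp
    finally show ?thesis
      using card_biembeddings_ge[OF assms(1) nk(1) _ _ nk(3,4)] nk(2) True
      by (meson of_nat_mono order_trans add_leD1 add_leD2 even_mult_iff)
  next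
    case False
    have pos: "0 < real (n * k)" using nk(3,4) by simp
    have "n * k \<le> (16 + t) * (16 + t)" using False nk(4) by (intro mult_le_mono) simp_all
    then have "real (n * k) \<le> C" unfolding C_def power2_eq_square by (rule of_nat_mono)
    then have "1 \<le> C / real (n * k)" using pos by (simp add: pos_le_divide_eq)
    then have "(1 - C / real (n * k)) * fact (n * k) \<le> 0" by (intro mult_nonpos_nonneg) simp_all
    then show ?thesis by (rule order_trans) simp
  qed
  show ?thesis
    unfolding Let_def by (intro exI[of _ C] allI impI main) auto
qed

end
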